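(* Let $R$ be a commutative ring and let $A^*$ be a differential graded (associative) $R$-algebra, with cohomological grading. Suppose that $A^*$ admits a multiplicative weight decomposition $$A^*=\bigoplus_{i\in\mathbb{Z}}A^*_i$$ such that, for every $i\in\mathbb{Z}$, the cohomology $H^i(A)$ is concentrated in weight $i$ (that is, $H^i(A^*_j)=0$ for all $j\neq i$). Then $A$ is formal.
   Context: A multiplicative weight decomposition of a dg-algebra $A^*$ is a direct sum decomposition $A^*=\bigoplus_{i\in\mathbb{Z}}A^*_i$ of the underlying cochain complex into subcomplexes (so the differential preserves the weight $i$ and raises the cohomological degree by one) such that $A^m_i\cdot A^n_j\subset A^{m+n}_{i+j}$ for all $i,j,m,n$. The cohomology then inherits a decomposition $H^n(A)=\bigoplus_i H^n(A^*_i)$. A dg-algebra $A$ is formal if there is a finite zig-zag of quasi-isomorphisms of dg-algebras connecting $A$ to its cohomology algebra $H^*(A)$, equipped with the induced product and zero differential. *)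

theory Defs
  imports "HOL-Algebra.Module" "HOL-Algebra.AbelCoset"
begin

text \<open>
  Modules reuse the record of \<^theory>\<open>HOL-Algebra.Module\<close>; its multiplicative fields
  carry no meaning for modules and are left unspecified.
\<close>

definition mod_hom ::
    "('r, 'k) ring_scheme \<Rightarrow> ('r, 'a, 'm) module_scheme \<Rightarrow> ('r, 'b, 'n) module_scheme \<Rightarrow> ('a \<Rightarrow> 'b) set"
  where "mod_hom R M N =
    {h \<in> carrier M \<rightarrow> carrier N.
       (\<forall>x\<in>carrier M. \<forall>y\<in>carrier M. h (x \<oplus>\<^bsub>M\<^esub> y) = h x \<oplus>\<^bsub>N\<^esub> h y) \<and>
       (\<forall>r\<in>carrier R. \<forall>x\<in>carrier M. h (r \<odot>\<^bsub>M\<^esub> x) = r \<odot>\<^bsub>N\<^esub> h x)}"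

text \<open>
  The quotient \<open>M / N\<close> has the cosets of \<open>N\<close> as elements. In \<open>smult\<close> the summand \<open>N\<close> is
  needed because \<open>{r x | x \<in> X}\<close> may be a proper subset of a coset.
\<close>

definition quotient_module :: "('r, 'a, 'm) module_scheme \<Rightarrow> 'a set \<Rightarrow> ('r, 'a set) module"
  where "quotient_module M N =
    \<lparr>carrier = a_rcosets\<^bsub>M\<^esub> N, mult = undefined, one = undefined,
     zero = N, add = (\<lambda>X Y. X <+>\<^bsub>M\<^esub> Y),
     smult = (\<lambda>r X. N <+>\<^bsub>M\<^esub> ((\<lambda>x. r \<odot>\<^bsub>M\<^esub> x) ` X))\<rparr>"

text \<open>
  Every element is uniquely a finite sum of elements of the \<open>N i\<close>: a decomposition is a
  finitely supported family.
\<close>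

definition internal_direct_sum ::
    "('r, 'k) ring_scheme \<Rightarrow> ('r, 'a, 'm) module_scheme \<Rightarrow> ('i \<Rightarrow> 'a set) \<Rightarrow> bool"
  where "internal_direct_sum R M N \<longleftrightarrow>
    (\<forall>i. submodule (N i) R M) \<and>
    (\<forall>x\<in>carrier M. \<exists>!f. (\<forall>i. f i \<in> N i) \<and> finite {i. f i \<noteq> \<zero>\<^bsub>M\<^esub>} \<and>
       x = (\<Oplus>\<^bsub>M\<^esub>i\<in>{i. f i \<noteq> \<zero>\<^bsub>M\<^esub>}. f i))"

record ('r, 'a) cochain_complex =
  cmod :: "int \<Rightarrow> ('r, 'a) module"
  cdiff :: "int \<Rightarrow> 'a \<Rightarrow> 'a"

locale cochain_complex =
  fixes R :: "('r, 'k) ring_scheme" and C :: "('r, 'a, 'c) cochain_complex_scheme"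
  assumes base_ring: "cring R"
    and module_cmod: "module R (cmod C n)"
    and cdiff_hom: "cdiff C n \<in> mod_hom R (cmod C n) (cmod C (n + 1))"
    and cdiff_cdiff: "x \<in> carrier (cmod C n) \<Longrightarrow> cdiff C (n + 1) (cdiff C n x) = \<zero>\<^bsub>cmod C (n + 2)\<^esub>"

definition cocycles :: "('r, 'a, 'c) cochain_complex_scheme \<Rightarrow> int \<Rightarrow> 'a set"
  where "cocycles C n = {x \<in> carrier (cmod C n). cdiff C n x = \<zero>\<^bsub>cmod C (n + 1)\<^esub>}"

definition coboundaries :: "('r, 'a, 'c) cochain_complex_scheme \<Rightarrow> int \<Rightarrow> 'a set"
  where "coboundaries C n = cdiff C (n - 1) ` carrier (cmod C (n - 1))"

definition cohomology :: "('r, 'a, 'c) cochain_complex_scheme \<Rightarrow> int \<Rightarrow> ('r, 'a set) module"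
  where "cohomology C n =
    quotient_module ((cmod C n)\<lparr>carrier := cocycles C n\<rparr>) (coboundaries C n)"

text \<open>
  The map induced by \<open>f\<close> on cohomology sends the class \<open>z + B\<close> to \<open>f z + B'\<close>, where \<open>B'\<close>
  are the coboundaries of the target \<open>D\<close>.
\<close>

definition cohomology_map ::
    "('r, 'b, 'd) cochain_complex_scheme \<Rightarrow> (int \<Rightarrow> 'a \<Rightarrow> 'b) \<Rightarrow> int \<Rightarrow> 'a set \<Rightarrow> 'b set"
  where "cohomology_map D f n X = coboundaries D n <+>\<^bsub>cmod D n\<^esub> (f n ` X)"

text \<open>
  Algebras are associative and unital, not necessarily commutative; \<open>gmult A m n\<close> is the product
  \<open>A\<^sup>m \<times> A\<^sup>n \<rightarrow> A\<^sup>m\<^sup>+\<^sup>n\<close>.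
\<close>

record ('r, 'a) dg_algebra = "('r, 'a) cochain_complex" +
  gmult :: "int \<Rightarrow> int \<Rightarrow> 'a \<Rightarrow> 'a \<Rightarrow> 'a"
  gone :: 'a

locale dg_algebra = cochain_complex R A
  for R :: "('r, 'k) ring_scheme" and A :: "('r, 'a, 'c) dg_algebra_scheme" +
  assumes gmult_hom_right: "x \<in> carrier (cmod A m) \<Longrightarrow>
      (\<lambda>y. gmult A m n x y) \<in> mod_hom R (cmod A n) (cmod A (m + n))"
    and gmult_hom_left: "y \<in> carrier (cmod A n) \<Longrightarrow>
      (\<lambda>x. gmult A m n x y) \<in> mod_hom R (cmod A m) (cmod A (m + n))"
    and gmult_assoc:
      "\<lbrakk>x \<in> carrier (cmod A m); y \<in> carrier (cmod A n); z \<in> carrier (cmod A p)\<rbrakk> \<Longrightarrow>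
       gmult A (m + n) p (gmult A m n x y) z = gmult A m (n + p) x (gmult A n p y z)"
    and gone_closed: "gone A \<in> carrier (cmod A 0)"
    and gone_left: "x \<in> carrier (cmod A n) \<Longrightarrow> gmult A 0 n (gone A) x = x"
    and gone_right: "x \<in> carrier (cmod A n) \<Longrightarrow> gmult A n 0 x (gone A) = x"
    and leibniz: "\<lbrakk>x \<in> carrier (cmod A m); y \<in> carrier (cmod A n)\<rbrakk> \<Longrightarrow>
       cdiff A (m + n) (gmult A m n x y) =
         gmult A (m + 1) n (cdiff A m x) y \<oplus>\<^bsub>cmod A (m + n + 1)\<^esub>
         (if even m then gmult A m (n + 1) x (cdiff A n y)
          else \<ominus>\<^bsub>cmod A (m + n + 1)\<^esub> gmult A m (n + 1) x (cdiff A n y))"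

definition cohomology_algebra ::
    "('r, 'a, 'c) dg_algebra_scheme \<Rightarrow> ('r, 'a set) dg_algebra"
  where "cohomology_algebra A =
    \<lparr>cmod = cohomology A,
     cdiff = (\<lambda>n X. \<zero>\<^bsub>cohomology A (n + 1)\<^esub>),
     gmult = (\<lambda>m n X Y. \<Union>x\<in>X. \<Union>y\<in>Y.
                coboundaries A (m + n) +>\<^bsub>cmod A (m + n)\<^esub> gmult A m n x y),
     gone = coboundaries A 0 +>\<^bsub>cmod A 0\<^esub> gone A\<rparr>"

definition dg_algebra_hom ::
    "('r, 'k) ring_scheme \<Rightarrow> ('r, 'a, 'c) dg_algebra_scheme \<Rightarrow> ('r, 'b, 'd) dg_algebra_scheme \<Rightarrow>
     (int \<Rightarrow> 'a \<Rightarrow> 'b) \<Rightarrow> bool"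
  where "dg_algebra_hom R A B f \<longleftrightarrow>
    (\<forall>n. f n \<in> mod_hom R (cmod A n) (cmod B n)) \<and>
    (\<forall>n. \<forall>x\<in>carrier (cmod A n). f (n + 1) (cdiff A n x) = cdiff B n (f n x)) \<and>
    (\<forall>m n. \<forall>x\<in>carrier (cmod A m). \<forall>y\<in>carrier (cmod A n).
       f (m + n) (gmult A m n x y) = gmult B m n (f m x) (f n y)) \<and>
    f 0 (gone A) = gone B"

definition quasi_isomorphism ::
    "('r, 'k) ring_scheme \<Rightarrow> ('r, 'a, 'c) dg_algebra_scheme \<Rightarrow> ('r, 'b, 'd) dg_algebra_scheme \<Rightarrow>
     (int \<Rightarrow> 'a \<Rightarrow> 'b) \<Rightarrow> bool"
  where "quasi_isomorphism R A B f \<longleftrightarrow>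
    dg_algebra_hom R A B f \<and>
    (\<forall>n. bij_betw (cohomology_map B f n) (carrier (cohomology A n)) (carrier (cohomology B n)))"

definition zigzag_step ::
    "('r, 'k) ring_scheme \<Rightarrow> ('r, 'a) dg_algebra \<Rightarrow> ('r, 'b) dg_algebra \<Rightarrow> bool"
  where "zigzag_step R A B \<longleftrightarrow>
    dg_algebra R A \<and> dg_algebra R B \<and>
    ((\<exists>f. quasi_isomorphism R A B f) \<or> (\<exists>g. quasi_isomorphism R B A g))"

text \<open>
  A zig-zag may pass through arbitrary dg-algebras, but the intermediate ones have to live in
  a fixed type. The type \<open>('r + 'a) list\<close> loses no zig-zags: two dg-algebras connected by any
  zig-zag are already connected by one of the form \<open>A \<leftarrow> Q \<rightarrow> H\<close> with \<open>Q\<close> a semi-free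
  resolution of \<open>A\<close>, whose cardinality is at most that of \<open>('r + 'a) list\<close>.
\<close>

definition formal :: "('r, 'k) ring_scheme \<Rightarrow> ('r, 'a) dg_algebra \<Rightarrow> bool"
  where "formal R A \<longleftrightarrow>
    (\<exists>X Y :: ('r, ('r + 'a) list) dg_algebra.
       zigzag_step R A X \<and> (zigzag_step R)\<^sup>*\<^sup>* X Y \<and> zigzag_step R Y (cohomology_algebra A))"

text \<open>\<open>W n i\<close> is the weight \<open>i\<close> part of \<open>A\<^sup>n\<close>.\<close>

locale multiplicative_weight_decomposition =
  fixes R :: "('r, 'k) ring_scheme" and A :: "('r, 'a, 'c) dg_algebra_scheme"
    and W :: "int \<Rightarrow> int \<Rightarrow> 'a set"
  assumes direct_sum: "internal_direct_sum R (cmod A n) (W n)"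
    and cdiff_weight: "x \<in> W n i \<Longrightarrow> cdiff A n x \<in> W (n + 1) i"
    and gmult_weight: "\<lbrakk>x \<in> W m i; y \<in> W n j\<rbrakk> \<Longrightarrow> gmult A m n x y \<in> W (m + n) (i + j)"

definition weight_subcomplex ::
    "('r, 'a, 'c) dg_algebra_scheme \<Rightarrow> (int \<Rightarrow> int \<Rightarrow> 'a set) \<Rightarrow> int \<Rightarrow> ('r, 'a) cochain_complex"
  where "weight_subcomplex A W i =
    \<lparr>cmod = (\<lambda>n. (cmod A n)\<lparr>carrier := W n i\<rparr>), cdiff = cdiff A\<rparr>"

end

theory Submission
  imports Defs
begin

text \<open>
  Let \<open>B\<close> consist in degree \<open>n\<close> of the elements of \<open>A\<^sup>n\<close> without components of weight below \<open>n\<close>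
  and whose component of weight \<open>n\<close> is a cocycle. Since weights add under multiplication, \<open>B\<close> is a
  dg-subalgebra, and the component of weight \<open>m + n\<close> of a product \<open>x y\<close> with \<open>x \<in> B\<^sup>m\<close> and \<open>y \<in> B\<^sup>n\<close> is
  the product of the components of weights \<open>m\<close> and \<open>n\<close>. Hence sending \<open>x \<in> B\<^sup>n\<close> to the class of its
  component of weight \<open>n\<close> is a map of dg-algebras \<open>B \<rightarrow> H(A)\<close>. As the cohomology of \<open>A\<close> in
  degree \<open>n\<close> lives in weight \<open>n\<close>, both \<open>B \<rightarrow> A\<close> and \<open>B \<rightarrow> H(A)\<close> are quasi-isomorphisms.
\<close>

section \<open>Module homomorphisms\<close>

lemma mod_homI:
  assumes "\<And>x. x \<in> carrier M \<Longrightarrow> h x \<in> carrier N"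
    and "\<And>x y. \<lbrakk>x \<in> carrier M; y \<in> carrier M\<rbrakk> \<Longrightarrow> h (x \<oplus>\<^bsub>M\<^esub> y) = h x \<oplus>\<^bsub>N\<^esub> h y"
    and "\<And>r x. \<lbrakk>r \<in> carrier R; x \<in> carrier M\<rbrakk> \<Longrightarrow> h (r \<odot>\<^bsub>M\<^esub> x) = r \<odot>\<^bsub>N\<^esub> h x"
  shows "h \<in> mod_hom R M N"
  using assms by (auto simp: mod_hom_def)

lemma mod_homD:
  assumes "h \<in> mod_hom R M N"
  shows mod_hom_closed: "x \<in> carrier M \<Longrightarrow> h x \<in> carrier N"
    and mod_hom_add: "\<lbrakk>x \<in> carrier M; y \<in> carrier M\<rbrakk> \<Longrightarrow> h (x \<oplus>\<^bsub>M\<^esub> y) = h x \<oplus>\<^bsub>N\<^esub> h y"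
    and mod_hom_smult: "\<lbrakk>r \<in> carrier R; x \<in> carrier M\<rbrakk> \<Longrightarrow> h (r \<odot>\<^bsub>M\<^esub> x) = r \<odot>\<^bsub>N\<^esub> h x"
  using assms by (auto simp: mod_hom_def)

lemma mod_hom_zero:
  assumes "h \<in> mod_hom R M N" "module R M" "module R N"
  shows "h \<zero>\<^bsub>M\<^esub> = \<zero>\<^bsub>N\<^esub>"
proof -
  interpret M: module R M by fact
  interpret N: module R N by fact
  have "h \<zero>\<^bsub>M\<^esub> \<oplus>\<^bsub>N\<^esub> h \<zero>\<^bsub>M\<^esub> = h \<zero>\<^bsub>M\<^esub>"
    by (metis M.M.r_zero M.M.zero_closed assms(1) mod_hom_add)
  then show ?thesis
    using mod_hom_closed[OF assms(1)] by (metis M.M.zero_closed N.M.add.r_cancel_one')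
qed

lemma mod_hom_uminus:
  assumes "h \<in> mod_hom R M N" "module R M" "module R N" "x \<in> carrier M"
  shows "h (\<ominus>\<^bsub>M\<^esub> x) = \<ominus>\<^bsub>N\<^esub> h x"
proof -
  interpret M: module R M by fact
  interpret N: module R N by fact
  have "h (\<ominus>\<^bsub>M\<^esub> x) \<oplus>\<^bsub>N\<^esub> h x = \<zero>\<^bsub>N\<^esub>"
    by (metis M.M.add.inv_closed M.M.l_neg assms mod_hom_add mod_hom_zero)
  then show ?thesis
    using mod_hom_closed[OF assms(1)] assms(4)
    by (metis M.M.add.inv_closed N.M.minus_equality)
qed

text \<open>The axioms pass along \<open>h\<close> from \<open>M\<close> to its image. Preservation
  of zero is a hypothesis of its own because nothing else ties the field \<open>zero\<close> of
  \<open>N\<close> to its addition.\<close>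

lemma module_surj_image:
  assumes M: "module R M" and h: "h \<in> mod_hom R M N"
    and surj: "h ` carrier M = carrier N" and zero: "h \<zero>\<^bsub>M\<^esub> = \<zero>\<^bsub>N\<^esub>"
  shows "module R N"
proof -
  interpret M: module R M by fact
  note hom = mod_hom_add[OF h, symmetric] mod_hom_smult[OF h, symmetric]
  show ?thesis
  proof (intro moduleI abelian_groupI M.cring_axioms, unfold surj[symmetric] zero[symmetric], goal_cases)
    \<comment> \<open>The existence of negatives: the image of a negative is a negative of the
      image.\<close>
    case 6
    then show ?case
      by (smt (verit) M.M.add.inv_closed M.M.l_neg hom(1) image_iff)
  qed (auto simp: hom M.M.a_ac M.smult_l_distr M.smult_r_distr M.smult_assoc1)
qed

lemma submodule_zero_closed: "submodule H R M \<Longrightarrow> \<zero>\<^bsub>M\<^esub> \<in> H"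
  using subgroup.one_closed[OF submodule.axioms(1)] by fastforce

text \<open>Negation is a definite description over the carrier, so it could change when the carrier
  shrinks. Since \<open>H\<close> contains the negative formed in \<open>M\<close>, uniqueness of
  negatives gives agreement.\<close>

lemma a_inv_submodule:
  assumes "module R M" "submodule H R M" "x \<in> H"
  shows "\<ominus>\<^bsub>M\<lparr>carrier := H\<rparr>\<^esub> x = \<ominus>\<^bsub>M\<^esub> x"
proof -
  interpret M: module R M by fact
  interpret H: module R "M\<lparr>carrier := H\<rparr>"
    using submodule.submodule_is_module assms by blast
  have "\<ominus>\<^bsub>M\<^esub> x \<in> H" "x \<in> carrier M"
    using M.submoduleE[OF assms(2)] assms(3) by auto
  then show ?thesis
    using H.M.minus_equality[of "\<ominus>\<^bsub>M\<^esub> x" x] assms(3) M.M.l_neg[of x] by simp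
qed

text \<open>As \<open>h\<close> maps \<open>B\<close> into \<open>B'\<close>, the image of a coset
  lies in one coset of \<open>B'\<close>, and adding \<open>B'\<close> fills that coset. Scalar
  multiplication on a quotient and the maps induced on cohomology are both defined by this
  formula.\<close>

lemma set_add_image_coset:
  fixes M (structure)
  assumes "abelian_group M" "abelian_group N"
    and closed: "\<And>x. x \<in> carrier M \<Longrightarrow> h x \<in> carrier N"
    and add: "\<And>x y. \<lbrakk>x \<in> carrier M; y \<in> carrier M\<rbrakk> \<Longrightarrow> h (x \<oplus> y) = h x \<oplus>\<^bsub>N\<^esub> h y"
    and sub: "B \<subseteq> carrier M" "\<zero> \<in> B" "h ` B \<subseteq> B'"
    and sub': "B' \<subseteq> carrier N" "\<And>x y. \<lbrakk>x \<in> B'; y \<in> B'\<rbrakk> \<Longrightarrow> x \<oplus>\<^bsub>N\<^esub> y \<in> B'"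
    and x: "x \<in> carrier M"
  shows "B' <+>\<^bsub>N\<^esub> (h ` (B +> x)) = B' +>\<^bsub>N\<^esub> h x"
proof -
  interpret M: abelian_group M by fact
  interpret N: abelian_group N by fact
  have *: "b' \<oplus>\<^bsub>N\<^esub> h (b \<oplus> x) = (b' \<oplus>\<^bsub>N\<^esub> h b) \<oplus>\<^bsub>N\<^esub> h x" if "b \<in> B" "b' \<in> B'" for b b'
    using that sub sub' x closed by (auto simp: add N.a_assoc subset_iff)
  show ?thesis
  proof (intro equalityI subsetI)
    fix y assume "y \<in> B' <+>\<^bsub>N\<^esub> (h ` (B +> x))"
    then obtain b b' where "b \<in> B" "b' \<in> B'" "y = b' \<oplus>\<^bsub>N\<^esub> h (b \<oplus> x)"
      by (auto simp: set_add_def' a_r_coset_def')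
    then show "y \<in> B' +>\<^bsub>N\<^esub> h x"
      using * sub(3) sub'(2)[of b' "h b"] by (force simp: a_r_coset_def')
  next
    fix y assume "y \<in> B' +>\<^bsub>N\<^esub> h x"
    then obtain b' where "b' \<in> B'" "y = b' \<oplus>\<^bsub>N\<^esub> h x"
      by (auto simp: a_r_coset_def')
    then have "y = b' \<oplus>\<^bsub>N\<^esub> h (\<zero> \<oplus> x)" using x by simp
    with \<open>b' \<in> B'\<close> sub show "y \<in> B' <+>\<^bsub>N\<^esub> (h ` (B +> x))"
      by (auto simp: set_add_def' a_r_coset_def')
  qed
qed


section \<open>Components of a direct sum\<close>

definition component :: "('r, 'a, 'm) module_scheme \<Rightarrow> ('i \<Rightarrow> 'a set) \<Rightarrow> 'a \<Rightarrow> 'i \<Rightarrow> 'a"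
  where "component M N x = (THE f. (\<forall>i. f i \<in> N i) \<and> finite {i. f i \<noteq> \<zero>\<^bsub>M\<^esub>} \<and>
       x = (\<Oplus>\<^bsub>M\<^esub>i\<in>{i. f i \<noteq> \<zero>\<^bsub>M\<^esub>}. f i))"

locale module_direct_sum = module R M
  for R :: "('r, 'k) ring_scheme" and M :: "('r, 'a, 'm) module_scheme" (structure) +
  fixes N :: "'i \<Rightarrow> 'a set"
  assumes direct_sum: "internal_direct_sum R M N"
begin

lemma submodule_summand: "submodule (N i) R M"
  using direct_sum by (simp add: internal_direct_sum_def)

lemma summand_closed: "x \<in> N i \<Longrightarrow> x \<in> carrier M"
  using submoduleE(1)[OF submodule_summand] by blast

lemma zero_in_summand: "\<zero>\<^bsub>M\<^esub> \<in> N i"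
  using submodule_zero_closed submodule_summand by blast

lemma component:
  assumes "x \<in> carrier M"
  shows component_in: "component M N x i \<in> N i"
    and component_finite: "finite {i. component M N x i \<noteq> \<zero>\<^bsub>M\<^esub>}"
    and component_finsum: "x = (\<Oplus>\<^bsub>M\<^esub>i\<in>{i. component M N x i \<noteq> \<zero>\<^bsub>M\<^esub>}. component M N x i)"
proof -
  have "\<exists>!f. (\<forall>i. f i \<in> N i) \<and> finite {i. f i \<noteq> \<zero>\<^bsub>M\<^esub>} \<and>
       x = (\<Oplus>\<^bsub>M\<^esub>i\<in>{i. f i \<noteq> \<zero>\<^bsub>M\<^esub>}. f i)"
    using direct_sum assms unfolding internal_direct_sum_def by blast
  from theI'[OF this, folded component_def]
  show "component M N x i \<in> N i" "finite {i. component M N x i \<noteq> \<zero>\<^bsub>M\<^esub>}"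
    "x = (\<Oplus>\<^bsub>M\<^esub>i\<in>{i. component M N x i \<noteq> \<zero>\<^bsub>M\<^esub>}. component M N x i)"
    by blast+
qed

lemma component_closed: "x \<in> carrier M \<Longrightarrow> component M N x i \<in> carrier M"
  using component_in summand_closed by blast

text \<open>Enlarging the index set beyond the support only adds zeros, so several families can be
  summed over one common finite set.\<close>

lemma finsum_support:
  assumes "\<And>i. f i \<in> N i" "finite F" "\<And>i. i \<notin> F \<Longrightarrow> f i = \<zero>\<^bsub>M\<^esub>"
  shows "(\<Oplus>\<^bsub>M\<^esub>i\<in>{i. f i \<noteq> \<zero>\<^bsub>M\<^esub>}. f i) = (\<Oplus>\<^bsub>M\<^esub>i\<in>F. f i)"
  using assms summand_closed by (intro M.add.finprod_mono_neutral_cong_left) auto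

lemma component_unique:
  assumes f: "\<And>i. f i \<in> N i" and F: "finite F" "\<And>i. i \<notin> F \<Longrightarrow> f i = \<zero>\<^bsub>M\<^esub>"
    and x: "x = (\<Oplus>\<^bsub>M\<^esub>i\<in>F. f i)"
  shows "component M N x = f"
proof -
  have xM: "x \<in> carrier M"
    unfolding x using f summand_closed by (intro M.finsum_closed) auto
  have "finite {i. f i \<noteq> \<zero>\<^bsub>M\<^esub>}"
    using F by (metis (mono_tags, lifting) finite_subset mem_Collect_eq subsetI)
  moreover have "x = (\<Oplus>\<^bsub>M\<^esub>i\<in>{i. f i \<noteq> \<zero>\<^bsub>M\<^esub>}. f i)"
    using finsum_support[OF f F] x by simp
  moreover have "\<exists>!f. (\<forall>i. f i \<in> N i) \<and> finite {i. f i \<noteq> \<zero>\<^bsub>M\<^esub>} \<and>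
       x = (\<Oplus>\<^bsub>M\<^esub>i\<in>{i. f i \<noteq> \<zero>\<^bsub>M\<^esub>}. f i)"
    using direct_sum xM unfolding internal_direct_sum_def by blast
  ultimately show ?thesis
    unfolding component_def using f by (intro the1_equality) auto
qed

text \<open>Over the union of the two supports the families can be added termwise, and uniqueness of
  decompositions identifies the result.\<close>

lemma component_add:
  assumes "x \<in> carrier M" "y \<in> carrier M"
  shows "component M N (x \<oplus>\<^bsub>M\<^esub> y) i = component M N x i \<oplus>\<^bsub>M\<^esub> component M N y i"
proof -
  let ?F = "{i. component M N x i \<noteq> \<zero>\<^bsub>M\<^esub>} \<union> {i. component M N y i \<noteq> \<zero>\<^bsub>M\<^esub>}"
  have F: "finite ?F" using component_finite assms by simp
  have "z = (\<Oplus>\<^bsub>M\<^esub>i\<in>?F. component M N z i)" if "z \<in> {x, y}" for z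
    using that assms component_finsum[of z] 
      finsum_support[where f = "component M N z", OF _ F] component_in[of z] by auto
  then have "x = (\<Oplus>\<^bsub>M\<^esub>i\<in>?F. component M N x i)" "y = (\<Oplus>\<^bsub>M\<^esub>i\<in>?F. component M N y i)"
    by auto
  then have "x \<oplus>\<^bsub>M\<^esub> y = (\<Oplus>\<^bsub>M\<^esub>i\<in>?F. component M N x i \<oplus>\<^bsub>M\<^esub> component M N y i)"
    using M.finsum_addf[of "component M N x" ?F "component M N y"] component_closed assms
    by (simp add: Pi_def)
  then have "component M N (x \<oplus>\<^bsub>M\<^esub> y) = (\<lambda>i. component M N x i \<oplus>\<^bsub>M\<^esub> component M N y i)"
    using assms component_in submoduleE(5)[OF submodule_summand]
    by (intro component_unique[OF _ F]) auto
  then show ?thesis by simp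
qed

lemma component_homogeneous:
  assumes "x \<in> N j"
  shows "component M N x i = (if i = j then x else \<zero>\<^bsub>M\<^esub>)"
proof -
  have "x = (\<Oplus>\<^bsub>M\<^esub>i\<in>{j}. if i = j then x else \<zero>\<^bsub>M\<^esub>)"
    using summand_closed[OF assms] by simp
  then have "component M N x = (\<lambda>i. if i = j then x else \<zero>\<^bsub>M\<^esub>)"
    using assms zero_in_summand by (intro component_unique[of _ "{j}"]) auto
  then show ?thesis by simp
qed

lemma component_zero: "component M N \<zero>\<^bsub>M\<^esub> i = \<zero>\<^bsub>M\<^esub>"
  by (metis (full_types) component_homogeneous zero_in_summand)

text \<open>An element is a finite sum of its components. This is the principle by which additive
  statements are reduced to homogeneous elements.\<close>

lemma mem_if_components:
  assumes x: "x \<in> carrier M" and zero: "\<zero>\<^bsub>M\<^esub> \<in> S"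
    and add: "\<And>x y. \<lbrakk>x \<in> S; y \<in> S\<rbrakk> \<Longrightarrow> x \<oplus>\<^bsub>M\<^esub> y \<in> S"
    and comp: "\<And>i. component M N x i \<in> S"
  shows "x \<in> S"
proof -
  have "(\<Oplus>\<^bsub>M\<^esub>i\<in>F. component M N x i) \<in> S" if "finite F" for F
    using that by induction (auto simp: zero add comp component_closed[OF x] Pi_def)
  then show ?thesis
    using component_finsum[OF x] component_finite[OF x] by metis
qed

end


text \<open>Both sides are additive in \<open>x\<close>, so homogeneous \<open>x\<close> suffice.
  Injectivity of \<open>\<sigma>\<close> keeps a summand other than the one with index
  \<open>i\<close> from landing in index \<open>\<sigma> i\<close>. The reindexing
  \<open>\<sigma>\<close> allows for multiplication by a homogeneous element, which shifts
  weights.\<close>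

lemma component_hom:
  assumes "module_direct_sum R M N" "module_direct_sum R M' N'" "inj \<sigma>"
    and closed: "\<And>x. x \<in> carrier M \<Longrightarrow> h x \<in> carrier M'"
    and add: "\<And>x y. \<lbrakk>x \<in> carrier M; y \<in> carrier M\<rbrakk> \<Longrightarrow> h (x \<oplus>\<^bsub>M\<^esub> y) = h x \<oplus>\<^bsub>M'\<^esub> h y"
    and zero: "h \<zero>\<^bsub>M\<^esub> = \<zero>\<^bsub>M'\<^esub>"
    and hN: "\<And>i x. x \<in> N i \<Longrightarrow> h x \<in> N' (\<sigma> i)"
    and x: "x \<in> carrier M"
  shows "component M' N' (h x) (\<sigma> i) = h (component M N x i)"
proof -
  interpret M: module_direct_sum R M N by fact
  interpret M': module_direct_sum R M' N' by fact
  let ?S = "{x \<in> carrier M. component M' N' (h x) (\<sigma> i) = h (component M N x i)}"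
  have "x \<in> ?S"
  proof (rule M.mem_if_components[OF x])
    show "\<zero>\<^bsub>M\<^esub> \<in> ?S" by (simp add: zero M.component_zero M'.component_zero)
  next
    fix y z assume "y \<in> ?S" "z \<in> ?S"
    then show "y \<oplus>\<^bsub>M\<^esub> z \<in> ?S"
      by (simp add: add closed M.component_add M'.component_add M.component_closed)
  next
    fix j
    have y: "component M N x j \<in> N j" using M.component_in x by blast
    show "component M N x j \<in> ?S"
      using M.component_homogeneous[OF y] M'.component_homogeneous[OF hN[OF y]]
        M.component_closed[OF x] \<open>inj \<sigma>\<close> by (auto simp: zero inj_eq)
  qed
  then show ?thesis by simp
qed

lemma (in module_direct_sum) component_mod_hom:
  "(\<lambda>x. component M N x i) \<in> mod_hom R M M"
proof (rule mod_homI)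
  fix r x assume r: "r \<in> carrier R" and x: "x \<in> carrier M"
  show "component M N (r \<odot>\<^bsub>M\<^esub> x) i = r \<odot>\<^bsub>M\<^esub> component M N x i"
    using r x submodule.smult_closed[OF submodule_summand]
    by (intro component_hom[where \<sigma> = id and h = "\<lambda>x. r \<odot>\<^bsub>M\<^esub> x", simplified,
          OF module_direct_sum_axioms module_direct_sum_axioms]) (auto simp: smult_r_distr)
qed (auto simp: component_closed component_add)


section \<open>Cohomology\<close>

abbreviation cohomology_class :: "('r, 'a, 'c) cochain_complex_scheme \<Rightarrow> int \<Rightarrow> 'a \<Rightarrow> 'a set"
  where "cohomology_class C n x \<equiv> coboundaries C n +>\<^bsub>cmod C n\<^esub> x"

context cochain_complex
begin

lemma abelian_group_cmod: "abelian_group (cmod C n)"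
  using module_cmod module.axioms(2) by blast

lemma cdiff_closed: "x \<in> carrier (cmod C n) \<Longrightarrow> cdiff C n x \<in> carrier (cmod C (n + 1))"
  by (rule mod_hom_closed[OF cdiff_hom])

lemma cdiff_zero: "cdiff C n \<zero>\<^bsub>cmod C n\<^esub> = \<zero>\<^bsub>cmod C (n + 1)\<^esub>"
  by (rule mod_hom_zero[OF cdiff_hom module_cmod module_cmod])

lemma submodule_cocycles: "submodule (cocycles C n) R (cmod C n)"
proof -
  interpret M: module R "cmod C n" by (rule module_cmod)
  interpret N: module R "cmod C (n + 1)" by (rule module_cmod)
  show ?thesis
    by (rule M.submoduleI)
      (auto simp: cocycles_def cdiff_zero mod_hom_add[OF cdiff_hom] mod_hom_smult[OF cdiff_hom]
        mod_hom_uminus[OF cdiff_hom module_cmod module_cmod])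
qed

text \<open>Writing the degree as \<open>n + 1\<close> matches the target
  \<open>cmod C (n + 1)\<close> of the differential literally and removes the subtraction from the
  definition.\<close>

lemma coboundaries_iff: "y \<in> coboundaries C (n + 1) \<longleftrightarrow> (\<exists>x\<in>carrier (cmod C n). y = cdiff C n x)"
  by (auto simp: coboundaries_def)

lemma submodule_coboundaries: "submodule (coboundaries C n) R (cmod C n)"
proof -
  define m where "m = n - 1"
  then have n: "n = m + 1" by simp
  interpret M: module R "cmod C m" by (rule module_cmod)
  interpret N: module R "cmod C (m + 1)" by (rule module_cmod)
  have "submodule (coboundaries C (m + 1)) R (cmod C (m + 1))"
  proof (rule N.submoduleI)
    show "coboundaries C (m + 1) \<subseteq> carrier (cmod C (m + 1))"
      using cdiff_closed[of _ m] by (auto simp: coboundaries_iff)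
    show "\<zero>\<^bsub>cmod C (m + 1)\<^esub> \<in> coboundaries C (m + 1)"
      unfolding coboundaries_iff cdiff_zero[symmetric] by blast
  next
    fix a assume "a \<in> coboundaries C (m + 1)"
    then show "\<ominus>\<^bsub>cmod C (m + 1)\<^esub> a \<in> coboundaries C (m + 1)"
      unfolding coboundaries_iff
      using mod_hom_uminus[OF cdiff_hom module_cmod module_cmod, symmetric] by blast
  next
    fix a b assume "a \<in> coboundaries C (m + 1)" "b \<in> coboundaries C (m + 1)"
    then show "a \<oplus>\<^bsub>cmod C (m + 1)\<^esub> b \<in> coboundaries C (m + 1)"
      unfolding coboundaries_iff
      using mod_hom_add[OF cdiff_hom, symmetric] by blast
  next
    fix r a assume "r \<in> carrier R" "a \<in> coboundaries C (m + 1)"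
    then show "r \<odot>\<^bsub>cmod C (m + 1)\<^esub> a \<in> coboundaries C (m + 1)"
      unfolding coboundaries_iff
      using mod_hom_smult[OF cdiff_hom, symmetric] by blast
  qed
  then show ?thesis by (simp add: n)
qed

lemma coboundaries_subset_cocycles: "coboundaries C n \<subseteq> cocycles C n"
proof -
  define m where "m = n - 1"
  then have n: "n = m + 1" by simp
  show ?thesis
    unfolding n using cdiff_closed[of _ m] cdiff_cdiff[of _ m]
    by (auto simp: coboundaries_iff cocycles_def add.assoc)
qed

lemma abelian_subgroup_coboundaries: "abelian_subgroup (coboundaries C n) (cmod C n)"
  using submodule_coboundaries abelian_group_cmod
  by (intro abelian_subgroupI3 additive_subgroup.intro submodule.axioms(1))

lemma cocycles_closed: "x \<in> cocycles C n \<Longrightarrow> x \<in> carrier (cmod C n)"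
  by (simp add: cocycles_def)

lemma coboundaries_closed: "x \<in> coboundaries C n \<Longrightarrow> x \<in> carrier (cmod C n)"
  using coboundaries_subset_cocycles cocycles_closed by blast

lemma cohomology_class_eq_iff:
  assumes "x \<in> carrier (cmod C n)" "y \<in> carrier (cmod C n)"
  shows "cohomology_class C n x = cohomology_class C n y \<longleftrightarrow>
    (\<exists>b\<in>coboundaries C n. x = b \<oplus>\<^bsub>cmod C n\<^esub> y)"
proof -
  interpret B: abelian_subgroup "coboundaries C n" "cmod C n"
    by (rule abelian_subgroup_coboundaries)
  have "cohomology_class C n x = cohomology_class C n y \<longleftrightarrow> x \<in> cohomology_class C n y"
    using B.a_rcos_self B.a_repr_independence' assms by metis
  then show ?thesis by (auto simp: a_r_coset_def')
qed

lemma cohomology_class_coboundary: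
  assumes "x \<in> carrier (cmod C n)"
  shows "cohomology_class C n x = coboundaries C n \<longleftrightarrow> x \<in> coboundaries C n"
proof -
  interpret B: abelian_subgroup "coboundaries C n" "cmod C n"
    by (rule abelian_subgroup_coboundaries)
  show ?thesis
    using B.a_rcos_self B.a_rcos_const assms by metis
qed

lemma carrier_cohomology: "carrier (cohomology C n) = cohomology_class C n ` cocycles C n"
  by (auto simp: cohomology_def quotient_module_def A_RCOSETS_def' a_r_coset_def')

lemma cohomology_zero: "\<zero>\<^bsub>cohomology C n\<^esub> = coboundaries C n"
  by (simp add: cohomology_def quotient_module_def)

lemma cohomology_class_zero: "cohomology_class C n \<zero>\<^bsub>cmod C n\<^esub> = \<zero>\<^bsub>cohomology C n\<^esub>"
  using cohomology_class_coboundary[of "\<zero>\<^bsub>cmod C n\<^esub>" n] submodule_zero_closed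
    submodule_coboundaries coboundaries_closed
  by (metis cohomology_zero)

lemma cohomology_class_hom:
  "cohomology_class C n \<in> mod_hom R ((cmod C n)\<lparr>carrier := cocycles C n\<rparr>) (cohomology C n)"
proof -
  interpret B: abelian_subgroup "coboundaries C n" "cmod C n"
    by (rule abelian_subgroup_coboundaries)
  interpret M: module R "cmod C n" by (rule module_cmod)
  have add: "X \<oplus>\<^bsub>cohomology C n\<^esub> Y = X <+>\<^bsub>cmod C n\<^esub> Y" for X Y
    by (simp add: cohomology_def quotient_module_def set_add_def')
  have smult: "r \<odot>\<^bsub>cohomology C n\<^esub> X =
    coboundaries C n <+>\<^bsub>cmod C n\<^esub> ((\<lambda>x. r \<odot>\<^bsub>cmod C n\<^esub> x) ` X)" for r X
    by (simp add: cohomology_def quotient_module_def set_add_def')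
  show ?thesis
  proof (rule mod_homI, goal_cases)
    case (1 x)
    then show ?case by (simp add: carrier_cohomology)
  next
    case (2 x y)
    then show ?case by (simp add: add B.a_rcos_sum cocycles_closed)
  next
    case (3 r x)
    \<comment> \<open>Scalar multiplication on the quotient has the shape of
      \<open>set_add_image_coset\<close>, with multiplication by \<open>r\<close> as the map and the
      coboundaries as both subgroups.\<close>
    have "coboundaries C n <+>\<^bsub>cmod C n\<^esub> ((\<lambda>x. r \<odot>\<^bsub>cmod C n\<^esub> x) ` cohomology_class C n x)
      = cohomology_class C n (r \<odot>\<^bsub>cmod C n\<^esub> x)"
      using 3 M.submoduleE[OF submodule_coboundaries[of n]]
      by (intro set_add_image_coset abelian_group_cmod)
        (auto simp: M.smult_r_distr cocycles_closed)
    then show ?case by (simp add: smult)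
  qed
qed

end

text \<open>A chain map sends coboundaries to coboundaries, so \<open>set_add_image_coset\<close>
  evaluates the induced map on a single representative.\<close>

lemma cohomology_map_class:
  assumes C: "cochain_complex R C" and D: "cochain_complex R D"
    and f: "\<And>n. f n \<in> mod_hom R (cmod C n) (cmod D n)"
    and d: "\<And>n x. x \<in> carrier (cmod C n) \<Longrightarrow> f (n + 1) (cdiff C n x) = cdiff D n (f n x)"
    and x: "x \<in> carrier (cmod C n)"
  shows "cohomology_map D f n (cohomology_class C n x) = cohomology_class D n (f n x)"
proof -
  interpret C: cochain_complex R C by fact
  interpret D: cochain_complex R D by fact
  interpret M: module R "cmod D n" by (rule D.module_cmod)
  have "f n y \<in> coboundaries D n" if "y \<in> coboundaries C n" for y
    using that d[of _ "n - 1"] mod_hom_closed[OF f] by (auto simp: coboundaries_def)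
  then show ?thesis
    unfolding cohomology_map_def
    using x M.submoduleE(1,5)[OF D.submodule_coboundaries[of n]] mod_homD[OF f]
      submodule_zero_closed[OF C.submodule_coboundaries] C.coboundaries_closed
    by (intro set_add_image_coset C.abelian_group_cmod D.abelian_group_cmod) auto
qed


section \<open>Differential graded algebras\<close>

lemma dg_algebra_homD:
  assumes "dg_algebra_hom R A B f"
  shows dg_algebra_hom_mod_hom: "f n \<in> mod_hom R (cmod A n) (cmod B n)"
    and dg_algebra_hom_cdiff: "x \<in> carrier (cmod A n) \<Longrightarrow> f (n + 1) (cdiff A n x) = cdiff B n (f n x)"
    and dg_algebra_hom_gmult: "\<lbrakk>x \<in> carrier (cmod A m); y \<in> carrier (cmod A n)\<rbrakk> \<Longrightarrow>
      f (m + n) (gmult A m n x y) = gmult B m n (f m x) (f n y)"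
    and dg_algebra_hom_gone: "f 0 (gone A) = gone B"
  using assms by (auto simp: dg_algebra_hom_def)

text \<open>A class vanishes exactly when its representatives are coboundaries, and an additive map
  is injective once its kernel is trivial. Quasi-isomorphisms can thus be verified on
  representatives, without handling cosets.\<close>

lemma quasi_isomorphismI:
  assumes A: "cochain_complex R A" and B: "cochain_complex R B"
    and f: "dg_algebra_hom R A B f"
    and inj: "\<And>n x. \<lbrakk>x \<in> cocycles A n; f n x \<in> coboundaries B n\<rbrakk> \<Longrightarrow> x \<in> coboundaries A n"
    and surj: "\<And>n y. y \<in> cocycles B n \<Longrightarrow>
      \<exists>x\<in>cocycles A n. \<exists>b\<in>coboundaries B n. y = b \<oplus>\<^bsub>cmod B n\<^esub> f n x"
  shows "quasi_isomorphism R A B f"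
  unfolding quasi_isomorphism_def
proof (intro conjI allI f)
  fix n
  interpret A: cochain_complex R A by fact
  interpret B: cochain_complex R B by fact
  interpret M: module R "cmod A n" by (rule A.module_cmod)
  interpret N: module R "cmod B n" by (rule B.module_cmod)
  interpret Z: submodule "cocycles A n" R "cmod A n" by (rule A.submodule_cocycles)
  note fn = dg_algebra_hom_mod_hom[OF f, of n]
  have map: "cohomology_map B f n (cohomology_class A n x) = cohomology_class B n (f n x)"
    if "x \<in> cocycles A n" for x
    using that A.cocycles_closed
    by (intro cohomology_map_class[OF A B dg_algebra_homD(1,2)[OF f]]) auto
  have f_cocycle: "f n x \<in> cocycles B n" if "x \<in> cocycles A n" for x
    using that dg_algebra_hom_cdiff[OF f, of x n] mod_hom_closed[OF fn]
      mod_hom_zero[OF dg_algebra_hom_mod_hom[OF f] A.module_cmod B.module_cmod]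
    by (auto simp: cocycles_def)
  show "bij_betw (cohomology_map B f n) (carrier (cohomology A n)) (carrier (cohomology B n))"
    unfolding bij_betw_def A.carrier_cohomology B.carrier_cohomology
  proof (intro conjI subset_antisym, rule inj_onI)
    fix X Y assume "X \<in> cohomology_class A n ` cocycles A n" "Y \<in> cohomology_class A n ` cocycles A n"
      and eq: "cohomology_map B f n X = cohomology_map B f n Y"
    then obtain x y where xy: "x \<in> cocycles A n" "y \<in> cocycles A n"
      "X = cohomology_class A n x" "Y = cohomology_class A n y"
      by blast
    then have closed: "x \<in> carrier (cmod A n)" "y \<in> carrier (cmod A n)"
      using A.cocycles_closed by auto
    then have closed': "f n x \<in> carrier (cmod B n)" "f n y \<in> carrier (cmod B n)"
      using mod_hom_closed[OF fn] by auto
    obtain b where b: "b \<in> coboundaries B n" "f n x = b \<oplus>\<^bsub>cmod B n\<^esub> f n y"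
      using eq xy map closed' B.cohomology_class_eq_iff by metis
    \<comment> \<open>The difference of the representatives is a cocycle sent to the coboundary
      \<open>b\<close>, so \<open>inj\<close> makes it a coboundary.\<close>
    let ?z = "x \<oplus>\<^bsub>cmod A n\<^esub> \<ominus>\<^bsub>cmod A n\<^esub> y"
    have "f n ?z = f n x \<oplus>\<^bsub>cmod B n\<^esub> \<ominus>\<^bsub>cmod B n\<^esub> f n y"
      using closed by (simp add: mod_hom_add[OF fn] mod_hom_uminus[OF fn A.module_cmod B.module_cmod])
    also have "\<dots> = b"
      using b closed' B.coboundaries_closed by (simp add: N.M.a_assoc N.M.r_neg)
    finally have "f n ?z \<in> coboundaries B n" using b by simp
    moreover have "?z \<in> cocycles A n"
      using M.submoduleE(3,5)[OF A.submodule_cocycles] xy by blast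
    ultimately have "?z \<in> coboundaries A n" using inj by blast
    moreover have "x = ?z \<oplus>\<^bsub>cmod A n\<^esub> y"
      using closed by (simp add: M.M.a_assoc M.M.l_neg)
    ultimately show "X = Y"
      using xy closed A.cohomology_class_eq_iff by blast
  next
    show "cohomology_map B f n ` cohomology_class A n ` cocycles A n
      \<subseteq> cohomology_class B n ` cocycles B n"
      using map f_cocycle by auto
  next
    show "cohomology_class B n ` cocycles B n
      \<subseteq> cohomology_map B f n ` cohomology_class A n ` cocycles A n"
    proof (rule image_subsetI)
      fix y assume y: "y \<in> cocycles B n"
      then obtain x b where x: "x \<in> cocycles A n" "b \<in> coboundaries B n" "y = b \<oplus>\<^bsub>cmod B n\<^esub> f n x"
        using surj by blast
      then have "cohomology_class B n y = cohomology_class B n (f n x)"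
        using y f_cocycle B.cocycles_closed B.cohomology_class_eq_iff by metis
      then show "cohomology_class B n y \<in> cohomology_map B f n ` cohomology_class A n ` cocycles A n"
        using map x by auto
    qed
  qed
qed

text \<open>The converse of \<open>quasi_isomorphismI\<close>; it serves to move a quasi-isomorphism
  to a copy of its source, where cocycles and coboundaries are transported elementwise.\<close>

lemma quasi_isomorphismD:
  assumes A: "cochain_complex R A" and B: "cochain_complex R B"
    and f: "quasi_isomorphism R A B f"
  shows quasi_isomorphism_hom: "dg_algebra_hom R A B f"
    and quasi_isomorphism_inj:
      "\<lbrakk>x \<in> cocycles A n; f n x \<in> coboundaries B n\<rbrakk> \<Longrightarrow> x \<in> coboundaries A n"
    and quasi_isomorphism_surj:
      "y \<in> cocycles B n \<Longrightarrow> \<exists>x\<in>cocycles A n. \<exists>b\<in>coboundaries B n. y = b \<oplus>\<^bsub>cmod B n\<^esub> f n x"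
proof -
  interpret A: cochain_complex R A by fact
  interpret B: cochain_complex R B by fact
  have hom: "dg_algebra_hom R A B f"
    and bij: "bij_betw (cohomology_map B f n) (carrier (cohomology A n)) (carrier (cohomology B n))" for n
    using f by (auto simp: quasi_isomorphism_def)
  show "dg_algebra_hom R A B f" by (rule hom)
  note fn = dg_algebra_hom_mod_hom[OF hom]
  have map: "cohomology_map B f n (cohomology_class A n x) = cohomology_class B n (f n x)"
    if "x \<in> cocycles A n" for n x
    using that A.cocycles_closed
    by (intro cohomology_map_class[OF A B dg_algebra_homD(1,2)[OF hom]]) auto
  {
    assume x: "x \<in> cocycles A n" "f n x \<in> coboundaries B n"
    \<comment> \<open>Injectivity is about pairs of classes: those of \<open>x\<close> and of zero
      have the same image.\<close>
    let ?z = "\<zero>\<^bsub>cmod A n\<^esub>"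
    have z: "?z \<in> cocycles A n" "f n ?z \<in> coboundaries B n"
      using submodule_zero_closed A.submodule_cocycles B.submodule_coboundaries
        mod_hom_zero[OF fn A.module_cmod B.module_cmod] by metis+
    have "cohomology_map B f n (cohomology_class A n w) = coboundaries B n"
      if "w \<in> cocycles A n" "f n w \<in> coboundaries B n" for w
      using that map B.cohomology_class_coboundary B.coboundaries_closed by metis
    then have "cohomology_class A n x = cohomology_class A n ?z"
      using bij[of n] x z unfolding bij_betw_def A.carrier_cohomology
      by (metis imageI inj_onD)
    then show "x \<in> coboundaries A n"
      using A.cohomology_class_zero A.cohomology_zero A.cohomology_class_coboundary
        A.cocycles_closed x(1) by metis
  }
  {
    assume y: "y \<in> cocycles B n"
    then have "cohomology_class B n y \<in> cohomology_map B f n ` cohomology_class A n ` cocycles A n"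
      using bij[of n] unfolding bij_betw_def A.carrier_cohomology B.carrier_cohomology by blast
    then obtain x where x: "x \<in> cocycles A n" "cohomology_class B n y = cohomology_class B n (f n x)"
      using map by auto
    then show "\<exists>x\<in>cocycles A n. \<exists>b\<in>coboundaries B n. y = b \<oplus>\<^bsub>cmod B n\<^esub> f n x"
      using B.cohomology_class_eq_iff[of y n "f n x"] y A.cocycles_closed B.cocycles_closed
        mod_hom_closed[OF fn] by blast
  }
qed

text \<open>The operations of \<open>B\<close> on values of \<open>f\<close> are the images of those
  of \<open>A\<close>, so the axioms are inherited. This yields the dg-algebra structure both on the
  cohomology algebra, as an image of the cocycles, and on a copy of an algebra in another
  type.\<close>

lemma dg_algebra_surj_image:
  assumes A: "dg_algebra R A" and f: "dg_algebra_hom R A B f"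
    and surj: "\<And>n. f n ` carrier (cmod A n) = carrier (cmod B n)"
    and zero: "\<And>n. f n \<zero>\<^bsub>cmod A n\<^esub> = \<zero>\<^bsub>cmod B n\<^esub>"
  shows "dg_algebra R B"
proof -
  interpret A: dg_algebra R A by fact
  \<comment> \<open>Used from right to left, the homomorphism laws collect every expression in
    \<open>B\<close> under a single \<open>f\<close>.\<close>
  note hom = mod_hom_add[OF dg_algebra_hom_mod_hom[OF f], symmetric]
    mod_hom_smult[OF dg_algebra_hom_mod_hom[OF f], symmetric]
    dg_algebra_hom_cdiff[OF f, symmetric] dg_algebra_hom_gmult[OF f, symmetric]
    dg_algebra_hom_gone[OF f, symmetric]
  have module_B: "module R (cmod B n)" for n
    by (rule module_surj_image[OF A.module_cmod dg_algebra_hom_mod_hom[OF f] surj zero])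
  have gmult_closed: "gmult A m n x y \<in> carrier (cmod A (m + n))"
    if "x \<in> carrier (cmod A m)" "y \<in> carrier (cmod A n)" for m n x y
    using mod_hom_closed[OF A.gmult_hom_left] that by blast
  note closed = module.smult_closed[OF A.module_cmod] A.cdiff_closed gmult_closed
    abelian_monoid.a_closed[OF abelian_group.axioms(1)[OF A.abelian_group_cmod]]
    abelian_group.a_inv_closed[OF A.abelian_group_cmod]
  show ?thesis
  proof (intro dg_algebra.intro cochain_complex.intro dg_algebra_axioms.intro)
    show "cring R" by (rule A.base_ring)
    show "module R (cmod B n)" for n by (rule module_B)
    show "cdiff B n \<in> mod_hom R (cmod B n) (cmod B (n + 1))" for n
      by (rule mod_homI)
        (auto simp: surj[symmetric] hom closed mod_hom_add[OF A.cdiff_hom] mod_hom_smult[OF A.cdiff_hom])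
    show "(\<lambda>y. gmult B m n x y) \<in> mod_hom R (cmod B n) (cmod B (m + n))"
      if "x \<in> carrier (cmod B m)" for m n x
      using that
      by (intro mod_homI) (auto simp: surj[symmetric] hom closed
        mod_hom_add[OF A.gmult_hom_right] mod_hom_smult[OF A.gmult_hom_right])
    show "(\<lambda>x. gmult B m n x y) \<in> mod_hom R (cmod B m) (cmod B (m + n))"
      if "y \<in> carrier (cmod B n)" for m n y
      using that
      by (intro mod_homI) (auto simp: surj[symmetric] hom closed
        mod_hom_add[OF A.gmult_hom_left] mod_hom_smult[OF A.gmult_hom_left])
    show "gone B \<in> carrier (cmod B 0)"
      by (simp add: hom surj[symmetric] A.gone_closed)
    show "cdiff B (n + 1) (cdiff B n x) = \<zero>\<^bsub>cmod B (n + 2)\<^esub>" if x: "x \<in> carrier (cmod B n)" for n x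
    proof -
      obtain a where "a \<in> carrier (cmod A n)" "x = f n a"
        using x surj by blast
      then have "cdiff B (n + 1) (cdiff B n x) = f (n + 1 + 1) (cdiff A (n + 1) (cdiff A n a))"
        by (simp only: hom A.cdiff_closed)
      also have "n + 1 + 1 = n + 2" by simp
      finally show ?thesis
        using A.cdiff_cdiff[of a n] \<open>a \<in> carrier (cmod A n)\<close> by (simp only: zero)
    qed
    show "gmult B 0 n (gone B) x = x" if x: "x \<in> carrier (cmod B n)" for n x
    proof -
      obtain a where a: "a \<in> carrier (cmod A n)" "x = f n a"
        using x surj by blast
      have "gmult B 0 n (gone B) x = f (0 + n) (gmult A 0 n (gone A) a)"
        unfolding a(2) by (simp only: hom a(1) A.gone_closed)
      then show ?thesis using a A.gone_left by simp
    qed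
    show "gmult B n 0 x (gone B) = x" if x: "x \<in> carrier (cmod B n)" for n x
    proof -
      obtain a where a: "a \<in> carrier (cmod A n)" "x = f n a"
        using x surj by blast
      have "gmult B n 0 x (gone B) = f (n + 0) (gmult A n 0 a (gone A))"
        unfolding a(2) by (simp only: hom a(1) A.gone_closed)
      then show ?thesis using a A.gone_right by simp
    qed
    show "gmult B (m + n) p (gmult B m n x y) z = gmult B m (n + p) x (gmult B n p y z)"
      if xyz: "x \<in> carrier (cmod B m)" "y \<in> carrier (cmod B n)" "z \<in> carrier (cmod B p)" for m n p x y z
    proof -
      obtain a where a: "a \<in> carrier (cmod A m)" "x = f m a" using xyz(1) surj by blast
      obtain b where b: "b \<in> carrier (cmod A n)" "y = f n b" using xyz(2) surj by blast
      obtain c where c: "c \<in> carrier (cmod A p)" "z = f p c" using xyz(3) surj by blast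
      have "gmult B (m + n) p (gmult B m n x y) z = f (m + n + p) (gmult A (m + n) p (gmult A m n a b) c)"
        unfolding a(2) b(2) c(2) by (simp only: hom a(1) b(1) c(1) gmult_closed)
      also have "\<dots> = f (m + (n + p)) (gmult A m (n + p) a (gmult A n p b c))"
        by (simp only: A.gmult_assoc[OF a(1) b(1) c(1)] add.assoc)
      also have "\<dots> = gmult B m (n + p) x (gmult B n p y z)"
        unfolding a(2) b(2) c(2) by (simp only: hom a(1) b(1) c(1) gmult_closed)
      finally show ?thesis .
    qed
    show "cdiff B (m + n) (gmult B m n x y) =
         gmult B (m + 1) n (cdiff B m x) y \<oplus>\<^bsub>cmod B (m + n + 1)\<^esub>
         (if even m then gmult B m (n + 1) x (cdiff B n y)
          else \<ominus>\<^bsub>cmod B (m + n + 1)\<^esub> gmult B m (n + 1) x (cdiff B n y))"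
      if xy: "x \<in> carrier (cmod B m)" "y \<in> carrier (cmod B n)" for m n x y
    proof -
      obtain a where a: "a \<in> carrier (cmod A m)" "x = f m a" using xy(1) surj by blast
      obtain b where b: "b \<in> carrier (cmod A n)" "y = f n b" using xy(2) surj by blast
      \<comment> \<open>Degrees are arguments of \<open>f\<close>, \<open>cmod\<close> and the
        operations; the two terms of the Leibniz rule belong to the same module only after this
        arithmetic.\<close>
      have ix: "m + 1 + n = m + n + 1" "m + (n + 1) = m + n + 1" by simp_all
      let ?p = "gmult A (m + 1) n (cdiff A m a) b" and ?q = "gmult A m (n + 1) a (cdiff A n b)"
      have p: "?p \<in> carrier (cmod A (m + n + 1))"
        using gmult_closed[OF A.cdiff_closed[OF a(1)] b(1)] by (simp only: ix)
      have q: "?q \<in> carrier (cmod A (m + n + 1))"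
        using gmult_closed[OF a(1) A.cdiff_closed[OF b(1)]] by (simp only: ix)
      have "f (m + 1 + n) ?p = gmult B (m + 1) n (cdiff B m x) y"
        unfolding a(2) b(2) by (simp only: hom a(1) b(1) A.cdiff_closed)
      then have fp: "f (m + n + 1) ?p = gmult B (m + 1) n (cdiff B m x) y"
        by (simp only: ix)
      have "f (m + (n + 1)) ?q = gmult B m (n + 1) x (cdiff B n y)"
        unfolding a(2) b(2) by (simp only: hom a(1) b(1) A.cdiff_closed)
      then have fq: "f (m + n + 1) ?q = gmult B m (n + 1) x (cdiff B n y)"
        by (simp only: ix)
      have "cdiff B (m + n) (gmult B m n x y) = f (m + n + 1) (cdiff A (m + n) (gmult A m n a b))"
        unfolding a(2) b(2) by (simp only: hom a(1) b(1) gmult_closed)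
      also have "\<dots> = f (m + n + 1) (?p \<oplus>\<^bsub>cmod A (m + n + 1)\<^esub>
         (if even m then ?q else \<ominus>\<^bsub>cmod A (m + n + 1)\<^esub> ?q))"
        by (simp only: A.leibniz[OF a(1) b(1)])
      also have "\<dots> = f (m + n + 1) ?p \<oplus>\<^bsub>cmod B (m + n + 1)\<^esub>
         (if even m then f (m + n + 1) ?q else \<ominus>\<^bsub>cmod B (m + n + 1)\<^esub> f (m + n + 1) ?q)"
        using p q
        by (simp add: closed mod_hom_add[OF dg_algebra_hom_mod_hom[OF f]]
            mod_hom_uminus[OF dg_algebra_hom_mod_hom[OF f] A.module_cmod module_B])
      finally show ?thesis unfolding fp fq .
    qed
  qed
qed

section \<open>Subalgebras of a dg-algebra\<close>

definition sub_dg_algebra ::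
    "('r, 'a, 'c) dg_algebra_scheme \<Rightarrow> (int \<Rightarrow> 'a set) \<Rightarrow> ('r, 'a) dg_algebra"
  where "sub_dg_algebra A S =
    \<lparr>cmod = (\<lambda>n. (cmod A n)\<lparr>carrier := S n\<rparr>), cdiff = cdiff A, gmult = gmult A, gone = gone A\<rparr>"

lemma sub_dg_algebra_simps [simp]:
  "cmod (sub_dg_algebra A S) n = (cmod A n)\<lparr>carrier := S n\<rparr>"
  "cdiff (sub_dg_algebra A S) = cdiff A"
  "gmult (sub_dg_algebra A S) = gmult A"
  "gone (sub_dg_algebra A S) = gone A"
  by (simp_all add: sub_dg_algebra_def)

lemma (in dg_algebra) dg_algebra_sub:
  assumes sub: "\<And>n. submodule (S n) R (cmod A n)"
    and d: "\<And>n x. x \<in> S n \<Longrightarrow> cdiff A n x \<in> S (n + 1)"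
    and mult: "\<And>m n x y. \<lbrakk>x \<in> S m; y \<in> S n\<rbrakk> \<Longrightarrow> gmult A m n x y \<in> S (m + n)"
    and one: "gone A \<in> S 0"
  shows "dg_algebra R (sub_dg_algebra A S)"
proof -
  have closed: "x \<in> S n \<Longrightarrow> x \<in> carrier (cmod A n)" for n x
    using module.submoduleE(1)[OF module_cmod sub] by blast
  show ?thesis
  proof (intro dg_algebra.intro cochain_complex.intro dg_algebra_axioms.intro)
    show "module R (cmod (sub_dg_algebra A S) n)" for n
      using submodule.submodule_is_module[OF sub module_cmod] by simp
    show "cdiff (sub_dg_algebra A S) (m + n) (gmult (sub_dg_algebra A S) m n x y) =
         gmult (sub_dg_algebra A S) (m + 1) n (cdiff (sub_dg_algebra A S) m x) y
         \<oplus>\<^bsub>cmod (sub_dg_algebra A S) (m + n + 1)\<^esub>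
         (if even m then gmult (sub_dg_algebra A S) m (n + 1) x (cdiff (sub_dg_algebra A S) n y)
          else \<ominus>\<^bsub>cmod (sub_dg_algebra A S) (m + n + 1)\<^esub>
            gmult (sub_dg_algebra A S) m (n + 1) x (cdiff (sub_dg_algebra A S) n y))"
      if "x \<in> carrier (cmod (sub_dg_algebra A S) m)" "y \<in> carrier (cmod (sub_dg_algebra A S) n)"
      for m n x y
    proof -
      have xy: "x \<in> S m" "y \<in> S n" using that by auto
      \<comment> \<open>The sign in the Leibniz rule is a negation in the restricted module; it
        agrees with negation in \<open>A\<close> on elements of \<open>S\<close>.\<close>
      have "gmult A m (n + 1) x (cdiff A n y) \<in> S (m + n + 1)"
        using mult[OF xy(1) d[OF xy(2)]] by (simp add: add.assoc)
      then show ?thesis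
        using xy by (simp add: leibniz closed a_inv_submodule[OF module_cmod sub])
    qed
  qed (use closed mult one d in \<open>auto intro!: mod_homI simp: base_ring cdiff_cdiff gmult_assoc
     gone_left gone_right mod_hom_add[OF cdiff_hom] mod_hom_smult[OF cdiff_hom]
     mod_hom_add[OF gmult_hom_left] mod_hom_smult[OF gmult_hom_left]
     mod_hom_add[OF gmult_hom_right] mod_hom_smult[OF gmult_hom_right]\<close>)
qed


section \<open>Products of cocycles and the cohomology algebra\<close>

context dg_algebra
begin

lemma gmult_closed:
  "\<lbrakk>x \<in> carrier (cmod A m); y \<in> carrier (cmod A n)\<rbrakk> \<Longrightarrow> gmult A m n x y \<in> carrier (cmod A (m + n))"
  using mod_hom_closed[OF gmult_hom_left] by blast

lemma gmult_zero_left: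
  "y \<in> carrier (cmod A n) \<Longrightarrow> gmult A m n \<zero>\<^bsub>cmod A m\<^esub> y = \<zero>\<^bsub>cmod A (m + n)\<^esub>"
  by (rule mod_hom_zero[OF gmult_hom_left module_cmod module_cmod])

lemma gmult_zero_right:
  "x \<in> carrier (cmod A m) \<Longrightarrow> gmult A m n x \<zero>\<^bsub>cmod A n\<^esub> = \<zero>\<^bsub>cmod A (m + n)\<^esub>"
  by (rule mod_hom_zero[OF gmult_hom_right module_cmod module_cmod])

lemma cdiff_gmult_cocycle_left:
  assumes "x \<in> cocycles A m" "y \<in> carrier (cmod A n)"
  shows "cdiff A (m + n) (gmult A m n x y) =
    (if even m then gmult A m (n + 1) x (cdiff A n y)
     else \<ominus>\<^bsub>cmod A (m + n + 1)\<^esub> gmult A m (n + 1) x (cdiff A n y))"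
proof -
  interpret M: module R "cmod A (m + n + 1)" by (rule module_cmod)
  have x: "x \<in> carrier (cmod A m)" "cdiff A m x = \<zero>\<^bsub>cmod A (m + 1)\<^esub>"
    using assms by (auto simp: cocycles_def)
  have ix: "m + 1 + n = m + n + 1" "m + (n + 1) = m + n + 1" by simp_all
  have "gmult A m (n + 1) x (cdiff A n y) \<in> carrier (cmod A (m + n + 1))"
    using gmult_closed[OF x(1) cdiff_closed[OF assms(2)]] by (simp only: ix)
  moreover have "gmult A (m + 1) n (cdiff A m x) y = \<zero>\<^bsub>cmod A (m + n + 1)\<^esub>"
    using gmult_zero_left[OF assms(2), of "m + 1"] x(2) by (simp only: ix)
  ultimately show ?thesis
    using leibniz[OF x(1) assms(2)] by simp
qed

lemma cdiff_gmult_cocycle_right: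
  assumes "x \<in> carrier (cmod A m)" "y \<in> cocycles A n"
  shows "cdiff A (m + n) (gmult A m n x y) = gmult A (m + 1) n (cdiff A m x) y"
proof -
  interpret M: module R "cmod A (m + n + 1)" by (rule module_cmod)
  have y: "y \<in> carrier (cmod A n)" "cdiff A n y = \<zero>\<^bsub>cmod A (n + 1)\<^esub>"
    using assms by (auto simp: cocycles_def)
  have ix: "m + 1 + n = m + n + 1" "m + (n + 1) = m + n + 1" by simp_all
  have "gmult A (m + 1) n (cdiff A m x) y \<in> carrier (cmod A (m + n + 1))"
    using gmult_closed[OF cdiff_closed[OF assms(1)] y(1)] by (simp only: ix)
  moreover have "gmult A m (n + 1) x (cdiff A n y) = \<zero>\<^bsub>cmod A (m + n + 1)\<^esub>"
    using gmult_zero_right[OF assms(1), of "n + 1"] y(2) by (simp only: ix)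
  ultimately show ?thesis
    using leibniz[OF assms(1) y(1)] by simp
qed

lemma gmult_cocycles:
  assumes "x \<in> cocycles A m" "y \<in> cocycles A n"
  shows "gmult A m n x y \<in> cocycles A (m + n)"
proof -
  have xy: "x \<in> carrier (cmod A m)" "cdiff A m x = \<zero>\<^bsub>cmod A (m + 1)\<^esub>" "y \<in> carrier (cmod A n)"
    using assms by (auto simp: cocycles_def)
  have ix: "m + 1 + n = m + n + 1" by simp
  have "gmult A (m + 1) n (cdiff A m x) y = \<zero>\<^bsub>cmod A (m + n + 1)\<^esub>"
    using gmult_zero_left[OF xy(3), of "m + 1"] xy(2) by (simp only: ix)
  then show ?thesis
    using cdiff_gmult_cocycle_right[OF xy(1) assms(2)] gmult_closed[OF xy(1,3)]
    by (simp add: cocycles_def)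
qed

text \<open>The Leibniz rule for \<open>1 = 1 1\<close> reads
  \<open>d 1 = d 1 + d 1\<close>.\<close>

lemma gone_cocycle: "gone A \<in> cocycles A 0"
proof -
  interpret M: module R "cmod A 1" by (rule module_cmod)
  have d: "cdiff A 0 (gone A) \<in> carrier (cmod A 1)"
    using cdiff_closed[OF gone_closed] by simp
  have "cdiff A 0 (gone A) = cdiff A 0 (gone A) \<oplus>\<^bsub>cmod A 1\<^esub> cdiff A 0 (gone A)"
    using leibniz[OF gone_closed gone_closed] gone_left[OF gone_closed] gone_left[OF d]
      gone_right[OF d] by simp
  then have "cdiff A 0 (gone A) = \<zero>\<^bsub>cmod A 1\<^esub>"
    using d by (metis M.M.add.r_cancel_one')
  then show ?thesis by (simp add: cocycles_def gone_closed)
qed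

text \<open>If \<open>x = d w\<close> and \<open>d y = 0\<close>, then
  \<open>x y = d (w y)\<close>.\<close>

lemma gmult_coboundary_left:
  assumes "x \<in> coboundaries A m" "y \<in> cocycles A n"
  shows "gmult A m n x y \<in> coboundaries A (m + n)"
proof -
  obtain w where w: "w \<in> carrier (cmod A (m - 1))" "x = cdiff A (m - 1) w"
    using assms(1) by (auto simp: coboundaries_def)
  have ix: "m - 1 + n = m + n - 1" "m - 1 + 1 = m" by simp_all
  show ?thesis
    using cdiff_gmult_cocycle_right[OF w(1) assms(2)]
      gmult_closed[OF w(1) cocycles_closed[OF assms(2)]] w(2)
    unfolding coboundaries_def ix by (metis imageI)
qed

text \<open>If \<open>y = d w\<close> and \<open>d x = 0\<close>, then \<open>x y\<close> equals
  \<open>d (x w)\<close> up to the sign given by the parity of \<open>m\<close>, and coboundaries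
  are closed under negation.\<close>

lemma gmult_coboundary_right:
  assumes "x \<in> cocycles A m" "y \<in> coboundaries A n"
  shows "gmult A m n x y \<in> coboundaries A (m + n)"
proof -
  interpret M: module R "cmod A (m + n)" by (rule module_cmod)
  obtain w where w: "w \<in> carrier (cmod A (n - 1))" "y = cdiff A (n - 1) w"
    using assms(2) by (auto simp: coboundaries_def)
  have ix: "m + (n - 1) = m + n - 1" "n - 1 + 1 = n" "m + n - 1 + 1 = m + n" by simp_all
  let ?p = "gmult A m n x y"
  have p: "?p \<in> carrier (cmod A (m + n))"
    using gmult_closed cocycles_closed[OF assms(1)] coboundaries_closed[OF assms(2)] by blast
  have "(if even m then ?p else \<ominus>\<^bsub>cmod A (m + n)\<^esub> ?p) \<in> coboundaries A (m + n)"
    using cdiff_gmult_cocycle_left[OF assms(1) w(1)]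
      gmult_closed[OF cocycles_closed[OF assms(1)] w(1)] w(2)
    unfolding coboundaries_def ix by (metis imageI)
  then show ?thesis
    using M.submoduleE(3)[OF submodule_coboundaries] p by (metis M.M.minus_minus)
qed

text \<open>With \<open>x' = b + x\<close> and \<open>y' = c + y\<close>, expanding first in
  \<open>x'\<close> and then in \<open>y'\<close> gives \<open>x' y' = b y' + x c + x y\<close>. The
  first two terms are products of a coboundary and a cocycle, hence coboundaries.\<close>

lemma cohomology_class_gmult:
  assumes x: "x \<in> cocycles A m" "x' \<in> cohomology_class A m x"
    and y: "y \<in> cocycles A n" "y' \<in> cohomology_class A n y"
  shows "cohomology_class A (m + n) (gmult A m n x' y') = cohomology_class A (m + n) (gmult A m n x y)"
proof -
  interpret M: module R "cmod A m" by (rule module_cmod)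
  interpret N: module R "cmod A n" by (rule module_cmod)
  interpret P: module R "cmod A (m + n)" by (rule module_cmod)
  obtain b where b: "b \<in> coboundaries A m" "x' = b \<oplus>\<^bsub>cmod A m\<^esub> x"
    using x(2) by (auto simp: a_r_coset_def')
  obtain c where c: "c \<in> coboundaries A n" "y' = c \<oplus>\<^bsub>cmod A n\<^esub> y"
    using y(2) by (auto simp: a_r_coset_def')
  have "c \<in> cocycles A n" using c(1) coboundaries_subset_cocycles by blast
  then have y': "y' \<in> cocycles A n"
    using c(2) y(1) N.submoduleE(5)[OF submodule_cocycles] by blast
  note closed = b(1)[THEN coboundaries_closed] c(1)[THEN coboundaries_closed]
    x(1)[THEN cocycles_closed] y(1)[THEN cocycles_closed] y'[THEN cocycles_closed]
  have x': "x' \<in> carrier (cmod A m)"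
    unfolding b(2) using closed(1,3) by (rule M.M.add.m_closed)
  let ?e = "gmult A m n b y' \<oplus>\<^bsub>cmod A (m + n)\<^esub> gmult A m n x c"
  have "gmult A m n x' y' = gmult A m n b y' \<oplus>\<^bsub>cmod A (m + n)\<^esub> gmult A m n x y'"
    unfolding b(2) using closed by (intro mod_hom_add[OF gmult_hom_left])
  also have "gmult A m n x y' = gmult A m n x c \<oplus>\<^bsub>cmod A (m + n)\<^esub> gmult A m n x y"
    unfolding c(2) using closed by (intro mod_hom_add[OF gmult_hom_right])
  finally have "gmult A m n x' y' = ?e \<oplus>\<^bsub>cmod A (m + n)\<^esub> gmult A m n x y"
    using gmult_closed[OF closed(1,5)] gmult_closed[OF closed(3,2)] gmult_closed[OF closed(3,4)]
    by (simp only: P.M.a_assoc)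
  moreover have "?e \<in> coboundaries A (m + n)"
    using P.submoduleE(5)[OF submodule_coboundaries] gmult_coboundary_left[OF b(1) y']
      gmult_coboundary_right[OF x(1) c(1)] by blast
  ultimately show ?thesis
    using cohomology_class_eq_iff[OF gmult_closed[OF x' closed(5)] gmult_closed[OF closed(3,4)]] by blast
qed

text \<open>The product of classes is a union over all pairs of representatives. All sets in this
  union coincide, and the union is over nonempty cosets.\<close>

lemma cohomology_algebra_gmult:
  assumes "x \<in> cocycles A m" "y \<in> cocycles A n"
  shows "gmult (cohomology_algebra A) m n (cohomology_class A m x) (cohomology_class A n y) =
    cohomology_class A (m + n) (gmult A m n x y)"
proof -
  interpret B: abelian_subgroup "coboundaries A m" "cmod A m"
    by (rule abelian_subgroup_coboundaries)
  interpret B': abelian_subgroup "coboundaries A n" "cmod A n"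
    by (rule abelian_subgroup_coboundaries)
  have "x \<in> cohomology_class A m x" "y \<in> cohomology_class A n y"
    using B.a_rcos_self B'.a_rcos_self assms cocycles_closed by auto
  moreover have "gmult (cohomology_algebra A) m n (cohomology_class A m x) (cohomology_class A n y) =
    (\<Union>x'\<in>cohomology_class A m x. \<Union>y'\<in>cohomology_class A n y. cohomology_class A (m + n) (gmult A m n x' y'))"
    by (simp add: cohomology_algebra_def)
  moreover have "\<dots> = (\<Union>x'\<in>cohomology_class A m x. \<Union>y'\<in>cohomology_class A n y.
      cohomology_class A (m + n) (gmult A m n x y))"
    using assms by (intro SUP_cong refl cohomology_class_gmult)
  ultimately show ?thesis by auto
qed

lemma cohomology_algebra_simps:
  "cmod (cohomology_algebra A) = cohomology A"
  "cdiff (cohomology_algebra A) n X = \<zero>\<^bsub>cohomology A (n + 1)\<^esub>"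
  "gone (cohomology_algebra A) = cohomology_class A 0 (gone A)"
  by (simp_all add: cohomology_algebra_def)

text \<open>The cocycles form a dg-subalgebra, on which the differential vanishes, and taking
  classes is a homomorphism from it onto the cohomology algebra.\<close>

lemma dg_algebra_cohomology_algebra: "dg_algebra R (cohomology_algebra A)"
proof (rule dg_algebra_surj_image)
  show "dg_algebra R (sub_dg_algebra A (cocycles A))"
  proof (intro dg_algebra_sub submodule_cocycles gmult_cocycles gone_cocycle)
    show "cdiff A n x \<in> cocycles A (n + 1)" if "x \<in> cocycles A n" for n x
      using that submodule_zero_closed[OF submodule_cocycles] by (simp add: cocycles_def)
  qed
  show "dg_algebra_hom R (sub_dg_algebra A (cocycles A)) (cohomology_algebra A) (cohomology_class A)"
    unfolding dg_algebra_hom_def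
    using cohomology_class_hom cohomology_class_zero
    by (auto simp: cohomology_algebra_simps cohomology_algebra_gmult cocycles_def)
qed (auto simp: cohomology_algebra_simps carrier_cohomology cohomology_class_zero)

end


section \<open>Change of the carrier type\<close>

definition transport_dg_algebra ::
    "('a \<Rightarrow> 'b) \<Rightarrow> ('r, 'a, 'c) dg_algebra_scheme \<Rightarrow> ('r, 'b) dg_algebra"
  where "transport_dg_algebra \<iota> A =
    \<lparr>cmod = (\<lambda>n. \<lparr>carrier = \<iota> ` carrier (cmod A n), mult = undefined, one = undefined,
       zero = \<iota> \<zero>\<^bsub>cmod A n\<^esub>, add = (\<lambda>x y. \<iota> (inv_into UNIV \<iota> x \<oplus>\<^bsub>cmod A n\<^esub> inv_into UNIV \<iota> y)),
       smult = (\<lambda>r x. \<iota> (r \<odot>\<^bsub>cmod A n\<^esub> inv_into UNIV \<iota> x))\<rparr>),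
     cdiff = (\<lambda>n x. \<iota> (cdiff A n (inv_into UNIV \<iota> x))),
     gmult = (\<lambda>m n x y. \<iota> (gmult A m n (inv_into UNIV \<iota> x) (inv_into UNIV \<iota> y))),
     gone = \<iota> (gone A)\<rparr>"

text \<open>The map \<open>\<iota>\<close> is itself a homomorphism onto the copy, since injectivity
  lets \<open>inv_into UNIV \<iota>\<close> recover the original elements.\<close>

lemma dg_algebra_transport:
  assumes "dg_algebra R A" "inj \<iota>"
  shows "dg_algebra R (transport_dg_algebra \<iota> A)"
  using assms(1)
  by (rule dg_algebra_surj_image[where f = "\<lambda>n. \<iota>"])
    (auto simp: dg_algebra_hom_def mod_hom_def transport_dg_algebra_def inv_f_f[OF assms(2)])

lemma quasi_isomorphism_transport:
  assumes A: "dg_algebra R A" and B: "dg_algebra R B" and \<iota>: "inj \<iota>"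
    and f: "quasi_isomorphism R A B f"
  shows "quasi_isomorphism R (transport_dg_algebra \<iota> A) B (\<lambda>n x. f n (inv_into UNIV \<iota> x))"
proof (rule quasi_isomorphismI)
  note A' = dg_algebra.axioms(1)[OF A] and B' = dg_algebra.axioms(1)[OF B]
  show "cochain_complex R (transport_dg_algebra \<iota> A)"
    using dg_algebra_transport[OF A \<iota>] by (rule dg_algebra.axioms(1))
  show "cochain_complex R B" by (rule B')
  show "dg_algebra_hom R (transport_dg_algebra \<iota> A) B (\<lambda>n x. f n (inv_into UNIV \<iota> x))"
    using quasi_isomorphism_hom[OF A' B' f]
    by (auto simp: dg_algebra_hom_def mod_hom_def transport_dg_algebra_def Pi_iff inv_f_f[OF \<iota>])
  have cocycles: "cocycles (transport_dg_algebra \<iota> A) n = \<iota> ` cocycles A n" for n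
    by (auto simp: cocycles_def transport_dg_algebra_def inv_f_f[OF \<iota>] inj_eq[OF \<iota>])
  have coboundaries: "coboundaries (transport_dg_algebra \<iota> A) n = \<iota> ` coboundaries A n" for n
    by (simp add: coboundaries_def transport_dg_algebra_def inv_f_f[OF \<iota>] image_image)
  show "x \<in> coboundaries (transport_dg_algebra \<iota> A) n"
    if "x \<in> cocycles (transport_dg_algebra \<iota> A) n" "f n (inv_into UNIV \<iota> x) \<in> coboundaries B n" for n x
    using that quasi_isomorphism_inj[OF A' B' f]
    by (auto simp: cocycles coboundaries inv_f_f[OF \<iota>])
  show "\<exists>x\<in>cocycles (transport_dg_algebra \<iota> A) n. \<exists>b\<in>coboundaries B n.
      y = b \<oplus>\<^bsub>cmod B n\<^esub> f n (inv_into UNIV \<iota> x)" if "y \<in> cocycles B n" for n y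
    using quasi_isomorphism_surj[OF A' B' f that] by (simp add: cocycles inv_f_f[OF \<iota>])
qed

text \<open>The middle algebra of a zig-zag has to live in the list type, so \<open>B\<close> is
  copied along singleton lists. The copy serves as both \<open>X\<close> and \<open>Y\<close>, and
  the chain between them is empty.\<close>

lemma formal_if_span:
  fixes A B :: "('r, 'a) dg_algebra"
  assumes A: "dg_algebra R A" and B: "dg_algebra R B"
    and f: "quasi_isomorphism R B A f" and g: "quasi_isomorphism R B (cohomology_algebra A) g"
  shows "formal R A"
proof -
  let ?\<iota> = "\<lambda>a. [Inr a :: 'r + 'a]"
  let ?X = "transport_dg_algebra ?\<iota> B"
  have \<iota>: "inj ?\<iota>" by (auto intro: injI)
  note H = dg_algebra.dg_algebra_cohomology_algebra[OF A]
  have "zigzag_step R A ?X" "zigzag_step R ?X (cohomology_algebra A)"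
    unfolding zigzag_step_def
    using A H dg_algebra_transport[OF B \<iota>] quasi_isomorphism_transport[OF B A \<iota> f]
      quasi_isomorphism_transport[OF B H \<iota> g] by blast+
  then show ?thesis unfolding formal_def by blast
qed


section \<open>The diagonal truncation\<close>

locale weighted_dg_algebra = dg_algebra R A + multiplicative_weight_decomposition R A W
  for R :: "('r, 'k) ring_scheme" and A :: "('r, 'a) dg_algebra" and W :: "int \<Rightarrow> int \<Rightarrow> 'a set" +
  assumes concentrated: "j \<noteq> i \<Longrightarrow>
      carrier (cohomology (weight_subcomplex A W j) i) =
        {\<zero>\<^bsub>cohomology (weight_subcomplex A W j) i\<^esub>}"
begin

section \<open>Weight components and the dg structure\<close>

abbreviation weight_part :: "int \<Rightarrow> int \<Rightarrow> 'a \<Rightarrow> 'a"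
  where "weight_part n i x \<equiv> component (cmod A n) (W n) x i"

lemma grading: "module_direct_sum R (cmod A n) (W n)"
  by (intro module_direct_sum.intro module_direct_sum_axioms.intro module_cmod direct_sum)

lemmas weight_closed = module_direct_sum.summand_closed[OF grading]
  and zero_in_weight = module_direct_sum.zero_in_summand[OF grading]
  and weight_part_in = module_direct_sum.component_in[OF grading]
  and weight_part_closed = module_direct_sum.component_closed[OF grading]
  and weight_part_hom = module_direct_sum.component_mod_hom[OF grading]
  and weight_part_homogeneous = module_direct_sum.component_homogeneous[OF grading]
  and weight_part_zero = module_direct_sum.component_zero[OF grading]
  and mem_if_weight_parts = module_direct_sum.mem_if_components[OF grading]

lemmas weight_part_add = mod_hom_add[OF weight_part_hom]
  and weight_part_smult = mod_hom_smult[OF weight_part_hom]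
  and weight_part_uminus = mod_hom_uminus[OF weight_part_hom module_cmod module_cmod]

lemma weight_part_cdiff:
  assumes "x \<in> carrier (cmod A n)"
  shows "weight_part (n + 1) i (cdiff A n x) = cdiff A n (weight_part n i x)"
  using component_hom[OF grading grading inj_on_id, where h = "cdiff A n"] assms
    mod_homD(1,2)[OF cdiff_hom] cdiff_zero cdiff_weight by auto

text \<open>Left multiplication by \<open>x\<close> shifts weights by \<open>i\<close>, so
  \<open>component_hom\<close> applies with \<open>(+) i\<close> as the reindexing.\<close>

lemma weight_part_gmult_left:
  assumes x: "x \<in> W m i" and y: "y \<in> carrier (cmod A n)"
  shows "weight_part (m + n) k (gmult A m n x y) = gmult A m n x (weight_part n (k - i) y)"
proof -
  note x' = weight_closed[OF x]
  have "weight_part (m + n) (i + (k - i)) (gmult A m n x y) = gmult A m n x (weight_part n (k - i) y)"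
  proof (rule component_hom[OF grading grading])
    show "inj ((+) i)" by simp
  qed (use x y gmult_weight mod_homD(1,2)[OF gmult_hom_right[OF x']] gmult_zero_right[OF x'] in auto)
  then show ?thesis by simp
qed

text \<open>Concentration makes the class of \<open>x\<close> in the subcomplex of weight
  \<open>i\<close> trivial. The primitive therefore has weight \<open>i\<close> as well, which is
  what allows primitives to be chosen weight by weight.\<close>

lemma exact_off_diagonal:
  assumes x: "x \<in> W n i" "i \<noteq> n" "cdiff A n x = \<zero>\<^bsub>cmod A (n + 1)\<^esub>"
  obtains w where "w \<in> W (n - 1) i" "x = cdiff A (n - 1) w"
proof -
  interpret M: module R "cmod A n" by (rule module_cmod)
  let ?C = "weight_subcomplex A W i"
  have "x \<in> cocycles ?C n"
    using x by (simp add: cocycles_def weight_subcomplex_def)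
  then have "coboundaries ?C n +>\<^bsub>cmod A n\<^esub> x \<in> carrier (cohomology ?C n)"
    by (auto simp: cohomology_def quotient_module_def A_RCOSETS_def' a_r_coset_def' weight_subcomplex_def)
  also have "\<dots> = {coboundaries ?C n}"
    using concentrated[of i n] x(2) by (simp add: cohomology_def quotient_module_def)
  finally have coset: "coboundaries ?C n +>\<^bsub>cmod A n\<^esub> x = coboundaries ?C n" by simp
  have cob: "coboundaries ?C n = cdiff A (n - 1) ` W (n - 1) i"
    by (simp add: coboundaries_def weight_subcomplex_def)
  have "\<zero>\<^bsub>cmod A n\<^esub> \<in> coboundaries ?C n"
    unfolding cob using cdiff_zero[of "n - 1"] zero_in_weight[of "n - 1" i]
    by (metis diff_add_cancel imageI)
  then have "\<zero>\<^bsub>cmod A n\<^esub> \<oplus>\<^bsub>cmod A n\<^esub> x \<in> coboundaries ?C n +>\<^bsub>cmod A n\<^esub> x"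
    by (auto simp: a_r_coset_def')
  then have "x \<in> cdiff A (n - 1) ` W (n - 1) i"
    using coset cob weight_closed[OF x(1)] by simp
  then show ?thesis using that by blast
qed

text \<open>Let \<open>e\<close> be the weight 0 part of the unit. Comparing parts of weight
  \<open>j\<close> in \<open>x 1 = x\<close> gives \<open>x e = x\<close> for \<open>x\<close> of
  degree 0 and weight \<open>j\<close>, hence for all \<open>x\<close> of degree 0 by additivity.
  Taking \<open>x = 1\<close> gives \<open>1 = e\<close>.\<close>

lemma gone_weight: "gone A \<in> W 0 0"
proof -
  let ?e = "weight_part 0 0 (gone A)"
  note e = weight_part_closed[OF gone_closed, of 0]
  interpret M: module R "cmod A 0" by (rule module_cmod)
  have right_unit: "gmult A 0 0 x ?e = x" if "x \<in> W 0 j" for x j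
    using weight_part_gmult_left[OF that gone_closed, of j] weight_closed[OF that]
      weight_part_homogeneous[OF that, of j] gone_right by simp
  have "gone A \<in> {x \<in> carrier (cmod A 0). gmult A 0 0 x ?e = x}"
    using mod_hom_add[OF gmult_hom_left[OF e, of 0]] gmult_zero_left[OF e, of 0]
      right_unit[OF weight_part_in[OF gone_closed]] weight_part_closed[OF gone_closed]
    by (intro mem_if_weight_parts[OF gone_closed]) auto
  then have "gone A = ?e"
    using gone_left[OF e] by simp
  then show ?thesis using weight_part_in[OF gone_closed] by metis
qed

text \<open>
  The weight \<open>i\<close> part of the truncation is the canonical truncation of the complex \<open>A\<^sub>i\<close> in degrees
  at most \<open>i\<close>.
\<close>

definition diagonal_truncation :: "int \<Rightarrow> 'a set"
  where "diagonal_truncation n = {x \<in> carrier (cmod A n).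
    (\<forall>i<n. weight_part n i x = \<zero>\<^bsub>cmod A n\<^esub>) \<and>
    cdiff A n (weight_part n n x) = \<zero>\<^bsub>cmod A (n + 1)\<^esub>}"

lemma truncation_closed: "x \<in> diagonal_truncation n \<Longrightarrow> x \<in> carrier (cmod A n)"
  by (simp add: diagonal_truncation_def)

lemma truncation_diagonal_cocycle:
  "x \<in> diagonal_truncation n \<Longrightarrow> weight_part n n x \<in> cocycles A n"
  by (simp add: diagonal_truncation_def cocycles_def weight_part_closed)

lemma homogeneous_in_truncation:
  assumes "x \<in> W n i" "n \<le> i" "i = n \<Longrightarrow> cdiff A n x = \<zero>\<^bsub>cmod A (n + 1)\<^esub>"
  shows "x \<in> diagonal_truncation n"
  using assms weight_closed[OF assms(1)] weight_part_homogeneous[OF assms(1)] cdiff_zero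
  by (auto simp: diagonal_truncation_def)

lemma submodule_truncation: "submodule (diagonal_truncation n) R (cmod A n)"
proof -
  interpret M: module R "cmod A n" by (rule module_cmod)
  interpret N: module R "cmod A (n + 1)" by (rule module_cmod)
  show ?thesis
    by (rule M.submoduleI)
      (auto simp: diagonal_truncation_def weight_part_zero cdiff_zero weight_part_add
        weight_part_smult weight_part_uminus weight_part_closed mod_hom_add[OF cdiff_hom]
        mod_hom_smult[OF cdiff_hom] mod_hom_uminus[OF cdiff_hom module_cmod module_cmod])
qed

text \<open>In \<open>x\<close> only weights from \<open>m\<close> on occur, in \<open>y\<close>
  only weights from \<open>n\<close> on. Hence nothing in the product has weight below
  \<open>m + n\<close>, and weight \<open>m + n\<close> arises only from the two diagonal
  parts.\<close>

lemma weight_part_gmult_truncation: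
  assumes x: "x \<in> diagonal_truncation m" and y: "y \<in> diagonal_truncation n" and k: "k \<le> m + n"
  shows "weight_part (m + n) k (gmult A m n x y) =
    (if k = m + n then gmult A m n (weight_part m m x) (weight_part n n y) else \<zero>\<^bsub>cmod A (m + n)\<^esub>)"
    (is "?l x = ?r x")
proof -
  interpret M: module R "cmod A m" by (rule module_cmod)
  interpret P: module R "cmod A (m + n)" by (rule module_cmod)
  note x' = truncation_closed[OF x] and y' = truncation_closed[OF y]
  note yn = weight_part_closed[OF y', of n]
  have "x \<in> {x \<in> carrier (cmod A m). ?l x = ?r x}" (is "x \<in> ?S")
  proof (rule mem_if_weight_parts[OF x'])
    show "\<zero>\<^bsub>cmod A m\<^esub> \<in> ?S"
      by (simp add: gmult_zero_left y' yn weight_part_zero)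
  next
    fix u v assume "u \<in> ?S" "v \<in> ?S"
    then show "u \<oplus>\<^bsub>cmod A m\<^esub> v \<in> ?S"
      by (auto simp: mod_hom_add[OF gmult_hom_left] y' yn weight_part_add gmult_closed
          weight_part_closed)
  next
    fix i
    let ?x = "weight_part m i x"
    have xi: "?x \<in> W m i" using weight_part_in[OF x'] .
    note xi' = weight_closed[OF xi]
    have l: "?l ?x = gmult A m n ?x (weight_part n (k - i) y)"
      by (rule weight_part_gmult_left[OF xi y'])
    \<comment> \<open>The part of \<open>x\<close> of weight \<open>i\<close> meets the part of
      \<open>y\<close> of weight \<open>k - i\<close>. Either one of these lies below the diagonal
      and vanishes, or both are diagonal.\<close>
    consider "i < m" | "i \<ge> m" "k - i < n" | "i = m" "k = m + n"
      using k by linarith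
    then have "?l ?x = ?r ?x"
    proof cases
      case 1
      then have "?x = \<zero>\<^bsub>cmod A m\<^esub>" using x by (simp add: diagonal_truncation_def)
      then show ?thesis by (simp add: gmult_zero_left y' yn weight_part_zero)
    next
      case 2
      then have "?l ?x = \<zero>\<^bsub>cmod A (m + n)\<^esub>"
        unfolding l using y gmult_zero_right[OF xi'] by (simp add: diagonal_truncation_def)
      \<comment> \<open>If \<open>k = m + n\<close>, then \<open>k - i < n\<close> forces
        \<open>i > m\<close>, so \<open>?x\<close> has no part of weight \<open>m\<close>.\<close>
      moreover have "?r ?x = \<zero>\<^bsub>cmod A (m + n)\<^esub>"
        using 2 weight_part_homogeneous[OF xi, of m] by (auto simp: gmult_zero_left yn)
      ultimately show ?thesis by simp
    next
      case 3
      then show ?thesis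
        using l weight_part_homogeneous[OF xi, of m] by simp
    qed
    then show "?x \<in> ?S" using xi' by simp
  qed
  then show ?thesis by simp
qed

section \<open>The truncation as a dg-algebra\<close>

abbreviation truncation :: "('r, 'a) dg_algebra"
  where "truncation \<equiv> sub_dg_algebra A diagonal_truncation"

lemma dg_algebra_truncation: "dg_algebra R truncation"
proof (rule dg_algebra_sub[OF submodule_truncation])
  fix n x assume x: "x \<in> diagonal_truncation n"
  \<comment> \<open>Weight \<open>n\<close> is on the diagonal for \<open>x\<close> but below it for
    \<open>d x\<close>; here the cocycle condition on the part of weight \<open>n\<close>
    enters.\<close>
  then have "weight_part (n + 1) i (cdiff A n x) = \<zero>\<^bsub>cmod A (n + 1)\<^esub>" if "i < n + 1" for i
    using that weight_part_cdiff[OF truncation_closed[OF x]] cdiff_zero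
    by (cases "i = n") (auto simp: diagonal_truncation_def)
  moreover have "cdiff A (n + 1) (weight_part (n + 1) (n + 1) (cdiff A n x)) = \<zero>\<^bsub>cmod A (n + 2)\<^esub>"
    unfolding weight_part_cdiff[OF truncation_closed[OF x]]
    by (rule cdiff_cdiff[OF weight_part_closed[OF truncation_closed[OF x]]])
  ultimately show "cdiff A n x \<in> diagonal_truncation (n + 1)"
    using cdiff_closed[OF truncation_closed[OF x]] by (simp add: diagonal_truncation_def add.assoc)
next
  fix m n x y assume xy: "x \<in> diagonal_truncation m" "y \<in> diagonal_truncation n"
  then have "gmult A m n (weight_part m m x) (weight_part n n y) \<in> cocycles A (m + n)"
    using gmult_cocycles truncation_diagonal_cocycle by blast
  then show "gmult A m n x y \<in> diagonal_truncation (m + n)"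
    unfolding diagonal_truncation_def
    using gmult_closed[OF xy[THEN truncation_closed]]
    by (simp add: weight_part_gmult_truncation[OF xy] cocycles_def)
next
  show "gone A \<in> diagonal_truncation 0"
    using homogeneous_in_truncation[OF gone_weight] gone_cocycle by (simp add: cocycles_def)
qed

section \<open>Comparison of the truncation with the algebra and its cohomology\<close>

lemma cocycles_truncation: "cocycles truncation n = diagonal_truncation n \<inter> cocycles A n"
  using truncation_closed by (auto simp: cocycles_def)

lemma coboundaries_truncation: "coboundaries truncation n = cdiff A (n - 1) ` diagonal_truncation (n - 1)"
  by (simp add: coboundaries_def)

text \<open>Coboundaries of the truncation are closed under sums, so primitives may be sought
  separately in each weight.\<close>

lemma coboundary_in_truncation:
  assumes x: "x \<in> carrier (cmod A n)"
    and parts: "\<And>i. weight_part n i x \<in> coboundaries truncation n"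
  shows "x \<in> coboundaries truncation n"
proof -
  interpret B: dg_algebra R truncation by (rule dg_algebra_truncation)
  interpret B: module R "cmod truncation n" by (rule B.module_cmod)
  show ?thesis
    using B.submoduleE(5)[OF B.submodule_coboundaries]
      submodule_zero_closed[OF B.submodule_coboundaries, of n] parts
    by (intro mem_if_weight_parts[OF x]) auto
qed

text \<open>Every part of a cocycle is a cocycle, and those off the diagonal are coboundaries by
  \<open>exact_off_diagonal\<close>. The element \<open>b\<close> is their sum.\<close>

lemma diagonal_part_cohomologous:
  assumes "x \<in> cocycles A n"
  obtains b where "b \<in> coboundaries A n" "x = b \<oplus>\<^bsub>cmod A n\<^esub> weight_part n n x"
proof -
  interpret M: module R "cmod A n" by (rule module_cmod)
  have x: "x \<in> carrier (cmod A n)" "cdiff A n x = \<zero>\<^bsub>cmod A (n + 1)\<^esub>"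
    using assms by (auto simp: cocycles_def)
  note xn = weight_part_closed[OF x(1), of n]
  let ?b = "x \<oplus>\<^bsub>cmod A n\<^esub> \<ominus>\<^bsub>cmod A n\<^esub> weight_part n n x"
  have part: "weight_part n i ?b = (if i = n then \<zero>\<^bsub>cmod A n\<^esub> else weight_part n i x)" for i
    using x xn weight_part_homogeneous[OF weight_part_in[OF x(1), of n], of i]
      weight_part_closed[OF x(1), of i]
    by (simp add: weight_part_add weight_part_uminus M.M.r_neg)
  have "?b \<in> coboundaries A n"
  proof (rule mem_if_weight_parts)
    show "weight_part n i ?b \<in> coboundaries A n" for i
    proof (cases "i = n")
      case True
      then show ?thesis using part submodule_zero_closed[OF submodule_coboundaries] by simp
    next
      case False
      have "cdiff A n (weight_part n i x) = \<zero>\<^bsub>cmod A (n + 1)\<^esub>"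
        using weight_part_cdiff[OF x(1)] x(2) weight_part_zero by metis
      then obtain w where "w \<in> W (n - 1) i" "weight_part n i x = cdiff A (n - 1) w"
        using exact_off_diagonal[OF weight_part_in[OF x(1)] False] by blast
      then show ?thesis
        using part False weight_closed by (auto simp: coboundaries_def)
    qed
  qed (use x xn M.submoduleE(5)[OF submodule_coboundaries] submodule_zero_closed[OF submodule_coboundaries] in auto)
  moreover have "x = ?b \<oplus>\<^bsub>cmod A n\<^esub> weight_part n n x"
    using x xn by (simp add: M.M.a_assoc M.M.l_neg)
  ultimately show ?thesis using that by blast
qed

text \<open>Diagonal parts are the representatives that give surjectivity on cohomology for both
  maps out of the truncation.\<close>

lemma diagonal_part_in_truncation:
  assumes "x \<in> cocycles A n"
  shows "weight_part n n x \<in> cocycles truncation n"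
proof -
  have x: "x \<in> carrier (cmod A n)" "cdiff A n x = \<zero>\<^bsub>cmod A (n + 1)\<^esub>"
    using assms by (auto simp: cocycles_def)
  have "cdiff A n (weight_part n n x) = \<zero>\<^bsub>cmod A (n + 1)\<^esub>"
    using weight_part_cdiff[OF x(1)] x(2) weight_part_zero by metis
  then show ?thesis
    using homogeneous_in_truncation[OF weight_part_in[OF x(1)]] weight_part_closed[OF x(1)]
    by (simp add: cocycles_truncation) (simp add: cocycles_def)
qed

lemma quasi_isomorphism_inclusion: "quasi_isomorphism R truncation A (\<lambda>n x. x)"
proof (rule quasi_isomorphismI)
  show "cochain_complex R truncation"
    using dg_algebra_truncation by (rule dg_algebra.axioms(1))
  show "cochain_complex R A" ..
  show "dg_algebra_hom R truncation A (\<lambda>n x. x)"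
    by (auto simp: dg_algebra_hom_def mod_hom_def truncation_closed)
next
  fix n x assume x: "x \<in> cocycles truncation n" "x \<in> coboundaries A n"
  then obtain w where w: "w \<in> carrier (cmod A (n - 1))" "x = cdiff A (n - 1) w"
    by (auto simp: coboundaries_def)
  have xT: "x \<in> diagonal_truncation n" "x \<in> carrier (cmod A n)"
    using x truncation_closed by (auto simp: cocycles_truncation)
  have part: "weight_part n i x = cdiff A (n - 1) (weight_part (n - 1) i w)" for i
    using weight_part_cdiff[OF w(1)] w(2) by simp
  show "x \<in> coboundaries truncation n"
  proof (rule coboundary_in_truncation[OF xT(2)])
    fix i
    show "weight_part n i x \<in> coboundaries truncation n"
    proof (cases "i < n")
      case True
      then have "weight_part n i x = cdiff A (n - 1) \<zero>\<^bsub>cmod A (n - 1)\<^esub>"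
        using xT cdiff_zero[of "n - 1"] by (simp add: diagonal_truncation_def)
      then show ?thesis
        unfolding coboundaries_truncation using submodule_zero_closed[OF submodule_truncation] by blast
    next
      case False
      \<comment> \<open>From \<open>i \<ge> n\<close> it follows that \<open>i > n - 1\<close>: in
        the degree of \<open>w\<close>, weight \<open>i\<close> lies strictly above the
        diagonal.\<close>
      then have "weight_part (n - 1) i w \<in> diagonal_truncation (n - 1)"
        by (intro homogeneous_in_truncation[OF weight_part_in[OF w(1)]]) auto
      then show ?thesis
        unfolding coboundaries_truncation part by blast
    qed
  qed
next
  fix n y assume "y \<in> cocycles A n"
  then show "\<exists>x\<in>cocycles truncation n. \<exists>b\<in>coboundaries A n. y = b \<oplus>\<^bsub>cmod A n\<^esub> x"
    using diagonal_part_cohomologous diagonal_part_in_truncation by metis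
qed

text \<open>The diagonal part of \<open>d x\<close> is \<open>d\<close> of a part of
  \<open>x\<close>, so its class is zero, in accordance with the zero differential. Multiplicativity
  is \<open>weight_part_gmult_truncation\<close> at \<open>k = m + n\<close>, and the unit has
  weight 0.\<close>

lemma dg_algebra_hom_diagonal_class:
  "dg_algebra_hom R truncation (cohomology_algebra A)
    (\<lambda>n x. cohomology_class A n (weight_part n n x))"
proof -
  note cls = mod_homD[OF cohomology_class_hom, simplified]
  have "cohomology_class A (n + 1) (weight_part (n + 1) (n + 1) (cdiff A n x)) = \<zero>\<^bsub>cohomology A (n + 1)\<^esub>"
    if "x \<in> diagonal_truncation n" for n x
  proof -
    have "weight_part (n + 1) (n + 1) (cdiff A n x) \<in> coboundaries A (n + 1)"
      unfolding weight_part_cdiff[OF truncation_closed[OF that]] coboundaries_iff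
      using weight_part_closed truncation_closed[OF that] by blast
    then show ?thesis
      using cohomology_class_coboundary coboundaries_closed cohomology_zero by metis
  qed
  moreover have "weight_part 0 0 (gone A) = gone A"
    using weight_part_homogeneous[OF gone_weight] by simp
  ultimately show ?thesis
    unfolding dg_algebra_hom_def
    by (auto intro!: mod_homI simp: cohomology_algebra_simps cls truncation_diagonal_cocycle
        weight_part_add weight_part_smult truncation_closed cohomology_algebra_gmult
        weight_part_gmult_truncation)
qed

lemma quasi_isomorphism_diagonal_class:
  "quasi_isomorphism R truncation (cohomology_algebra A)
    (\<lambda>n x. cohomology_class A n (weight_part n n x))"
proof (rule quasi_isomorphismI[OF _ _ dg_algebra_hom_diagonal_class])
  show "cochain_complex R truncation"
    using dg_algebra_truncation by (rule dg_algebra.axioms(1))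
  interpret H: dg_algebra R "cohomology_algebra A" by (rule dg_algebra_cohomology_algebra)
  show "cochain_complex R (cohomology_algebra A)" ..
  {
    fix n x assume x: "x \<in> cocycles truncation n"
      and cls: "cohomology_class A n (weight_part n n x) \<in> coboundaries (cohomology_algebra A) n"
    have xT: "x \<in> diagonal_truncation n" "x \<in> carrier (cmod A n)" "cdiff A n x = \<zero>\<^bsub>cmod A (n + 1)\<^esub>"
      using x truncation_closed by (auto simp: cocycles_truncation cocycles_def)
    \<comment> \<open>With zero differential, the zero class is the only coboundary of the
      cohomology algebra.\<close>
    have "cohomology_class A n (weight_part n n x) = coboundaries A n"
      using cls by (auto simp: coboundaries_def[of "cohomology_algebra A"] cohomology_algebra_simps cohomology_zero)
    then have "weight_part n n x \<in> coboundaries A n"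
      using cohomology_class_coboundary weight_part_closed[OF xT(2)] by blast
    then obtain u where u: "u \<in> carrier (cmod A (n - 1))" "weight_part n n x = cdiff A (n - 1) u"
      by (auto simp: coboundaries_def)
    show "x \<in> coboundaries truncation n"
    proof (rule coboundary_in_truncation[OF xT(2)])
      fix i
      have d: "cdiff A n (weight_part n i x) = \<zero>\<^bsub>cmod A (n + 1)\<^esub>"
        using weight_part_cdiff[OF xT(2)] xT(3) weight_part_zero by metis
      \<comment> \<open>Below the diagonal \<open>x\<close> vanishes, on it the vanishing class
        provides a primitive, and above it exactness off the diagonal does.\<close>
      consider "i < n" | "i = n" | "i > n" by linarith
      then obtain w where "w \<in> diagonal_truncation (n - 1)" "weight_part n i x = cdiff A (n - 1) w"
      proof cases
        case 1
        then have "weight_part n i x = cdiff A (n - 1) \<zero>\<^bsub>cmod A (n - 1)\<^esub>"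
          using xT cdiff_zero[of "n - 1"] by (simp add: diagonal_truncation_def)
        then show ?thesis
          using that submodule_zero_closed[OF submodule_truncation] by blast
      next
        case 2
        \<comment> \<open>The primitive \<open>u\<close> may have parts of any weight. Projecting to
          weight \<open>n\<close> leaves a primitive of degree \<open>n - 1\<close>, which lies
          above the diagonal and so in the truncation.\<close>
        have "weight_part n n x = weight_part n n (weight_part n n x)"
          using weight_part_homogeneous[OF weight_part_in[OF xT(2)], of n n] by simp
        also have "\<dots> = cdiff A (n - 1) (weight_part (n - 1) n u)"
          using weight_part_cdiff[OF u(1), of n] u(2) by simp
        finally show ?thesis
          using that 2 homogeneous_in_truncation[OF weight_part_in[OF u(1), of n]] by simp
      next
        case 3
        then obtain w where "w \<in> W (n - 1) i" "weight_part n i x = cdiff A (n - 1) w"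
          using exact_off_diagonal[OF weight_part_in[OF xT(2)] _ d] by blast
        then show ?thesis
          using that 3 homogeneous_in_truncation[of w "n - 1" i] by simp
      qed
      then show "weight_part n i x \<in> coboundaries truncation n"
        unfolding coboundaries_truncation by blast
    qed
  next
    fix n Y assume "Y \<in> cocycles (cohomology_algebra A) n"
    then obtain y where y: "y \<in> cocycles A n" "Y = cohomology_class A n y"
      using H.cocycles_closed carrier_cohomology by (auto simp: cohomology_algebra_simps)
    interpret N: module R "cohomology A n"
      using H.module_cmod[of n] by (simp add: cohomology_algebra_simps)
    have zero: "\<zero>\<^bsub>cohomology A n\<^esub> \<in> coboundaries (cohomology_algebra A) n"
      using submodule_zero_closed[OF H.submodule_coboundaries, of n] by (simp add: cohomology_algebra_simps)
    obtain b where b: "b \<in> coboundaries A n" "y = b \<oplus>\<^bsub>cmod A n\<^esub> weight_part n n y"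
      using diagonal_part_cohomologous[OF y(1)] .
    let ?x = "weight_part n n y"
    have x: "?x \<in> cocycles truncation n" by (rule diagonal_part_in_truncation[OF y(1)])
    have "weight_part n n ?x = ?x"
      using weight_part_homogeneous[OF weight_part_in[OF cocycles_closed[OF y(1)]], of n n] by simp
    moreover have "Y = cohomology_class A n ?x"
      using b y cohomology_class_eq_iff cocycles_closed[OF y(1)] weight_part_closed by blast
    moreover have "Y \<in> carrier (cohomology A n)"
      using y carrier_cohomology by blast
    ultimately have "Y = \<zero>\<^bsub>cohomology A n\<^esub> \<oplus>\<^bsub>cohomology A n\<^esub> cohomology_class A n (weight_part n n ?x)"
      by simp
    then show "\<exists>x\<in>cocycles truncation n. \<exists>b\<in>coboundaries (cohomology_algebra A) n.
        Y = b \<oplus>\<^bsub>cmod (cohomology_algebra A) n\<^esub> cohomology_class A n (weight_part n n x)"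
      unfolding cohomology_algebra_simps using x zero by blast
  }
qed

end

theorem mainTheorem1:
  fixes R :: "('r, 'k) ring_scheme" and A :: "('r, 'a) dg_algebra"
    and W :: "int \<Rightarrow> int \<Rightarrow> 'a set"
  assumes "cring R"
    and "dg_algebra R A"
    and "multiplicative_weight_decomposition R A W"
    and "\<And>i j. j \<noteq> i \<Longrightarrow>
      carrier (cohomology (weight_subcomplex A W j) i) =
        {\<zero>\<^bsub>cohomology (weight_subcomplex A W j) i\<^esub>}"
  shows "formal R A"
proof -
  interpret weighted_dg_algebra R A W
    using assms(2-4) by (intro weighted_dg_algebra.intro weighted_dg_algebra_axioms.intro)
  show ?thesis
    using formal_if_span dg_algebra_axioms dg_algebra_truncation quasi_isomorphism_inclusion
      quasi_isomorphism_diagonal_class by blast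
qed

end
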